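(* For $s\le0$ let $\mathcal{H}_s$ be the reproducing kernel Hilbert space of functions on $\mathbb{D}$ with kernel \[ K_s(z,w)=\sum_{n=0}^\infty(n+1)^s(z\overline w)^n . \] Then the spaces $\mathcal{H}_s$ have non-isomorphic multiplier algebras for distinct $s\le0$; that is, if $s,t\le0$ and $s\neq t$, then the algebras $\operatorname{Mult}(\mathcal{H}_s)$ and $\operatorname{Mult}(\mathcal{H}_t)$ are not isomorphic.
   Context: $\mathbb{D}$ is the open unit disc. For a reproducing kernel Hilbert space $\mathcal{H}$ of functions on $\mathbb{D}$, $\operatorname{Mult}(\mathcal{H})$ is the algebra of functions $g$ on $\mathbb{D}$ with $g\mathcal{H}\subset\mathcal{H}$. Isomorphism means isomorphism of algebras. *)

theory Defs
  imports "HOL-Analysis.Analysis" "HOL-Library.Function_Algebras"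
begin

text \<open>
  Functions on a set are total functions on a type, with the pointwise operations of
  \<^theory>\<open>HOL-Library.Function_Algebras\<close>.  The open unit disc is therefore made a type, so that a
  function on the disc has no values elsewhere.
\<close>

typedef disc = "{z :: complex. norm z < 1}"
  by (rule exI [of _ 0]) simp

definition ip_norm :: "(('x \<Rightarrow> complex) \<Rightarrow> ('x \<Rightarrow> complex) \<Rightarrow> complex) \<Rightarrow> ('x \<Rightarrow> complex) \<Rightarrow> real" where
  "ip_norm ip f = sqrt (Re (ip f f))"

text \<open>
  \<open>H\<close>, with the inner product \<open>ip\<close> (linear in the first argument, relevant only on \<open>H\<close>), is a
  reproducing kernel Hilbert space with kernel \<open>K\<close>.  By hermitian symmetry \<open>ip f f\<close> is real.
\<close>

locale rkhs =
  fixes H :: "('x \<Rightarrow> complex) set"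
    and ip :: "('x \<Rightarrow> complex) \<Rightarrow> ('x \<Rightarrow> complex) \<Rightarrow> complex"
    and K :: "'x \<Rightarrow> 'x \<Rightarrow> complex"
  assumes zero_mem: "0 \<in> H"
    and add_mem: "f \<in> H \<Longrightarrow> g \<in> H \<Longrightarrow> f + g \<in> H"
    and scale_mem: "f \<in> H \<Longrightarrow> (\<lambda>x. c * f x) \<in> H"
    and ip_add_left: "f \<in> H \<Longrightarrow> g \<in> H \<Longrightarrow> h \<in> H \<Longrightarrow> ip (f + g) h = ip f h + ip g h"
    and ip_scale_left: "f \<in> H \<Longrightarrow> h \<in> H \<Longrightarrow> ip (\<lambda>x. c * f x) h = c * ip f h"
    and ip_commute: "f \<in> H \<Longrightarrow> g \<in> H \<Longrightarrow> ip g f = cnj (ip f g)"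
    and ip_pos: "f \<in> H \<Longrightarrow> f \<noteq> 0 \<Longrightarrow> 0 < Re (ip f f)"
    and complete: "(\<And>n. u n \<in> H) \<Longrightarrow>
      (\<And>\<epsilon>. 0 < \<epsilon> \<Longrightarrow> \<exists>N. \<forall>m\<ge>N. \<forall>n\<ge>N. ip_norm ip (u m - u n) < \<epsilon>) \<Longrightarrow>
      \<exists>f\<in>H. (\<lambda>n. ip_norm ip (u n - f)) \<longlonglongrightarrow> 0"
    and kernel_mem: "(\<lambda>x. K x y) \<in> H"
    and reproducing: "f \<in> H \<Longrightarrow> f y = ip f (\<lambda>x. K x y)"

definition Mult :: "('x \<Rightarrow> complex) set \<Rightarrow> ('x \<Rightarrow> complex) set" where
  "Mult H = {g. \<forall>f\<in>H. g * f \<in> H}"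

definition algebra_iso ::
    "('x \<Rightarrow> complex) set \<Rightarrow> ('y \<Rightarrow> complex) set \<Rightarrow> (('x \<Rightarrow> complex) \<Rightarrow> ('y \<Rightarrow> complex)) \<Rightarrow> bool" where
  "algebra_iso A B \<phi> \<longleftrightarrow>
     bij_betw \<phi> A B \<and>
     (\<forall>f\<in>A. \<forall>g\<in>A. \<phi> (f + g) = \<phi> f + \<phi> g) \<and>
     (\<forall>c. \<forall>f\<in>A. \<phi> (\<lambda>x. c * f x) = (\<lambda>y. c * \<phi> f y)) \<and>
     (\<forall>f\<in>A. \<forall>g\<in>A. \<phi> (f * g) = \<phi> f * \<phi> g)"

definition algebras_isomorphic :: "('x \<Rightarrow> complex) set \<Rightarrow> ('y \<Rightarrow> complex) set \<Rightarrow> bool" where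
  "algebras_isomorphic A B \<longleftrightarrow> (\<exists>\<phi>. algebra_iso A B \<phi>)"

definition K_disc :: "real \<Rightarrow> disc \<Rightarrow> disc \<Rightarrow> complex" where
  "K_disc s z w =
     (\<Sum>n. of_real (real (n + 1) powr s) * (Rep_disc z * cnj (Rep_disc w)) ^ n)"

text \<open>
  The remainder shows that for \<open>s \<le> 0\<close> a space with kernel \<^term>\<open>K_disc s\<close> exists, so that
  quantifying over all \<open>H\<close> and \<open>ip\<close> with \<^term>\<open>rkhs H ip (K_disc s)\<close> is not vacuous.
\<close>

definition l2 :: "(nat \<Rightarrow> complex) set" where "l2 = {b. summable (\<lambda>n. (norm (b n))\<^sup>2)}"

lemma l2_prod: assumes "a \<in> l2" "b \<in> l2" shows "summable (\<lambda>n. a n * b n)"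
proof (rule summable_norm_cancel, rule summable_comparison_test)
  show "summable (\<lambda>n. (norm (a n))\<^sup>2 + (norm (b n))\<^sup>2)"
    using assms by (auto simp: l2_def intro: summable_add)
  have "norm (norm (a n * b n)) \<le> (norm (a n))\<^sup>2 + (norm (b n))\<^sup>2" for n
  proof -
    have "norm (a n) * norm (b n) \<ge> 0" by simp
    then have "norm (a n) * norm (b n) \<le> (norm (a n))\<^sup>2 + (norm (b n))\<^sup>2"
      using sum_squares_bound[of "norm (a n)" "norm (b n)"] unfolding mult.assoc by linarith
    then show ?thesis by (simp add: norm_mult)
  qed
  then show "\<exists>N. \<forall>n\<ge>N. norm (norm (a n * b n)) \<le> (norm (a n))\<^sup>2 + (norm (b n))\<^sup>2" by blast
qed

lemma l2_add: assumes "a \<in> l2" "b \<in> l2" shows "(\<lambda>n. a n + b n) \<in> l2"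
  unfolding l2_def mem_Collect_eq
proof (rule summable_comparison_test)
  show "summable (\<lambda>n. 2 * (norm (a n))\<^sup>2 + 2 * (norm (b n))\<^sup>2)"
    using assms by (auto simp: l2_def intro!: summable_add summable_mult)
  have "norm ((norm (a n + b n))\<^sup>2) \<le> 2 * (norm (a n))\<^sup>2 + 2 * (norm (b n))\<^sup>2" for n
  proof -
    have "(norm (a n + b n))\<^sup>2 \<le> (norm (a n) + norm (b n))\<^sup>2"
      by (intro power_mono norm_triangle_ineq) auto
    then show ?thesis using sum_squares_bound[of "norm (a n)" "norm (b n)"]
      by (simp add: power2_sum)
  qed
  then show "\<exists>N. \<forall>n\<ge>N. norm ((norm (a n + b n))\<^sup>2) \<le> 2 * (norm (a n))\<^sup>2 + 2 * (norm (b n))\<^sup>2" by blast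
qed

lemma l2_scale: "a \<in> l2 \<Longrightarrow> (\<lambda>n. c * a n) \<in> l2"
  by (auto simp: l2_def norm_mult power_mult_distrib intro!: summable_mult)

lemma l2_cnj: "a \<in> l2 \<Longrightarrow> (\<lambda>n. cnj (a n)) \<in> l2" by (simp add: l2_def)

lemma l2_diff: "a \<in> l2 \<Longrightarrow> b \<in> l2 \<Longrightarrow> (\<lambda>n. a n - b n) \<in> l2"
  using l2_add[of a "\<lambda>n. -1 * b n"] l2_scale[of b "-1"] by simp

definition l2_sq :: "(nat \<Rightarrow> complex) \<Rightarrow> real" where
  "l2_sq b = (\<Sum>n. (norm (b n))\<^sup>2)"

lemma l2_complete:
  assumes u: "\<And>k. u k \<in> l2"
    and C: "\<And>e. 0 < e \<Longrightarrow> \<exists>N. \<forall>m\<ge>N. \<forall>n\<ge>N. sqrt (l2_sq (\<lambda>i. u m i - u n i)) < e"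
  shows "\<exists>b\<in>l2. (\<lambda>k. sqrt (l2_sq (\<lambda>i. u k i - b i))) \<longlonglongrightarrow> 0"
proof -
  have part: "(\<Sum>i<M. (norm (a i))\<^sup>2) \<le> l2_sq a" if "a \<in> l2" for a M
    using that unfolding l2_sq_def l2_def by (intro sum_le_suminf) auto
  have coord: "norm (a i) \<le> sqrt (l2_sq a)" if "a \<in> l2" for a i
  proof -
    have "(norm (a i))\<^sup>2 \<le> (\<Sum>j<Suc i. (norm (a j))\<^sup>2)" by (simp add: sum_nonneg)
    also have "\<dots> \<le> l2_sq a" by (rule part[OF that])
    finally show ?thesis by (simp add: real_le_rsqrt)
  qed
  have "Cauchy (\<lambda>k. u k i)" for i
  proof (rule metric_CauchyI)
    fix e :: real assume "0 < e"
    from C[OF this] obtain N where N: "\<forall>m\<ge>N. \<forall>n\<ge>N. sqrt (l2_sq (\<lambda>i. u m i - u n i)) < e" by blast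
    have "dist (u m i) (u n i) < e" if "m \<ge> N" "n \<ge> N" for m n
      using N that coord[OF l2_diff[OF u[of m] u[of n]], of i] unfolding dist_norm
      by (meson le_less_trans)
    then show "\<exists>N. \<forall>m\<ge>N. \<forall>n\<ge>N. dist (u m i) (u n i) < e" by blast
  qed
  then have "\<exists>l. (\<lambda>k. u k i) \<longlonglongrightarrow> l" for i
    by (simp add: Cauchy_convergent_iff convergent_def)
  then obtain b where b: "\<And>i. (\<lambda>k. u k i) \<longlonglongrightarrow> b i" by metis
  have bnd: "\<exists>N. \<forall>m\<ge>N. (\<lambda>i. u m i - b i) \<in> l2 \<and> sqrt (l2_sq (\<lambda>i. u m i - b i)) \<le> e" if "0 < e" for e
  proof -
    from C[OF that] obtain N where N: "\<forall>m\<ge>N. \<forall>n\<ge>N. sqrt (l2_sq (\<lambda>i. u m i - u n i)) < e" by blast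
    have "(\<lambda>i. u m i - b i) \<in> l2 \<and> sqrt (l2_sq (\<lambda>i. u m i - b i)) \<le> e" if m: "m \<ge> N" for m
    proof -
      have P: "(\<Sum>i<M. (norm (u m i - b i))\<^sup>2) \<le> e\<^sup>2" for M
      proof (rule LIMSEQ_le_const2)
        show "(\<lambda>k. \<Sum>i<M. (norm (u m i - u k i))\<^sup>2) \<longlonglongrightarrow> (\<Sum>i<M. (norm (u m i - b i))\<^sup>2)"
          by (intro tendsto_intros b)
        have "(\<Sum>i<M. (norm (u m i - u k i))\<^sup>2) \<le> e\<^sup>2" if "k \<ge> N" for k
        proof -
          have "sqrt (l2_sq (\<lambda>i. u m i - u k i)) \<le> e" using N m that by (meson less_imp_le)
          then have "l2_sq (\<lambda>i. u m i - u k i) \<le> e\<^sup>2" using \<open>0 < e\<close> by (simp add: sqrt_le_D)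
          then show ?thesis using part[OF l2_diff[OF u u], of m k M] by linarith
        qed
        then show "\<exists>N. \<forall>k\<ge>N. (\<Sum>i<M. (norm (u m i - u k i))\<^sup>2) \<le> e\<^sup>2" by blast
      qed
      have S: "summable (\<lambda>i. (norm (u m i - b i))\<^sup>2)"
        by (rule summableI_nonneg_bounded[OF _ P]) simp
      then have "l2_sq (\<lambda>i. u m i - b i) \<le> e\<^sup>2" unfolding l2_sq_def by (rule suminf_le_const[OF _ P])
      then show ?thesis using S \<open>0 < e\<close> by (simp add: l2_def real_le_lsqrt)
    qed
    then show ?thesis by blast
  qed
  obtain N where "(\<lambda>i. u N i - b i) \<in> l2" using bnd[of 1] by auto
  then have "b \<in> l2" using l2_diff[OF u[of N], of "\<lambda>i. u N i - b i"] by simp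
  moreover have "(\<lambda>k. sqrt (l2_sq (\<lambda>i. u k i - b i))) \<longlonglongrightarrow> 0"
  proof (rule LIMSEQ_I)
    fix r :: real assume r: "0 < r"
    obtain N where N: "\<forall>m\<ge>N. (\<lambda>i. u m i - b i) \<in> l2 \<and> sqrt (l2_sq (\<lambda>i. u m i - b i)) \<le> r/2"
      using bnd[of "r/2"] r by auto
    have "norm (sqrt (l2_sq (\<lambda>i. u m i - b i)) - 0) < r" if "m \<ge> N" for m
    proof -
      have "(\<lambda>i. u m i - b i) \<in> l2" "sqrt (l2_sq (\<lambda>i. u m i - b i)) \<le> r/2" using N that by auto
      moreover from this have "0 \<le> sqrt (l2_sq (\<lambda>i. u m i - b i))"
        using coord norm_ge_zero order_trans by blast
      ultimately show ?thesis using r by simp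
    qed
    then show "\<exists>N. \<forall>m\<ge>N. norm (sqrt (l2_sq (\<lambda>i. u m i - b i)) - 0) < r" by blast
  qed
  ultimately show ?thesis by blast
qed

lemma rkhs_of_features:
  fixes e :: "'x \<Rightarrow> nat \<Rightarrow> complex"
  assumes e: "\<And>x. e x \<in> l2"
    and inj: "\<And>b. b \<in> l2 \<Longrightarrow> (\<And>x. (\<Sum>n. b n * e x n) = 0) \<Longrightarrow> b = (\<lambda>n. 0)"
  shows "\<exists>H ip. rkhs H ip (\<lambda>x y. \<Sum>n. cnj (e y n) * e x n)"
proof -
  define F where "F b = (\<lambda>x. \<Sum>n. b n * e x n)" for b
  have Fadd: "F (\<lambda>n. a n + b n) = F a + F b" if "a \<in> l2" "b \<in> l2" for a b
    unfolding F_def using l2_prod[OF that(1) e] l2_prod[OF that(2) e]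
    by (auto simp: fun_eq_iff algebra_simps suminf_add)
  have Fsc: "F (\<lambda>n. c * a n) = (\<lambda>x. c * F a x)" if "a \<in> l2" for a c
    unfolding F_def using l2_prod[OF that e]
    by (auto simp: fun_eq_iff mult.assoc suminf_mult)
  have Fdiff: "F (\<lambda>n. a n - b n) = F a - F b" if "a \<in> l2" "b \<in> l2" for a b
    unfolding F_def using l2_prod[OF that(1) e] l2_prod[OF that(2) e]
    by (auto simp: fun_eq_iff algebra_simps suminf_diff)
  have Finj: "a = b" if "a \<in> l2" "b \<in> l2" "F a = F b" for a b
  proof -
    have "F (\<lambda>n. a n - b n) = (\<lambda>x. 0)" using Fdiff[OF that(1,2)] that(3) by (simp add: fun_eq_iff)
    then have "(\<lambda>n. a n - b n) = (\<lambda>n. 0)"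
      by (intro inj l2_diff that) (metis F_def)
    then show ?thesis by (simp add: fun_eq_iff)
  qed
  define G where "G f = (THE b. b \<in> l2 \<and> F b = f)" for f
  have GF: "G (F b) = b" if "b \<in> l2" for b
    unfolding G_def by (rule the_equality) (use that Finj in auto)
  define ip where "ip f g = (\<Sum>n. G f n * cnj (G g n))" for f g
  have ipF: "ip (F a) (F b) = (\<Sum>n. a n * cnj (b n))" if "a \<in> l2" "b \<in> l2" for a b
    using that by (simp add: ip_def GF)
  have ipn: "ip (F a) (F a) = of_real (l2_sq a)" if "a \<in> l2" for a
    using that by (simp add: ipF l2_sq_def complex_norm_square [symmetric] l2_def
        suminf_of_real[symmetric] del: of_real_power)
  have nrm: "ip_norm ip (F a - F b) = sqrt (l2_sq (\<lambda>n. a n - b n))" if "a \<in> l2" "b \<in> l2" for a b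
    using that by (simp add: ip_norm_def Fdiff[symmetric] ipn l2_diff)
  have "rkhs (F ` l2) ip (\<lambda>x y. \<Sum>n. cnj (e y n) * e x n)"
  proof
    have "F (\<lambda>n. 0) = 0" "(\<lambda>n. 0) \<in> l2" by (auto simp: F_def fun_eq_iff l2_def)
    then show "0 \<in> F ` l2" by (metis imageI)
  next
    fix f g assume "f \<in> F ` l2" "g \<in> F ` l2"
    then show "f + g \<in> F ` l2" by (auto simp: Fadd[symmetric] l2_add)
  next
    fix f c assume "f \<in> F ` l2"
    then show "(\<lambda>x. c * f x) \<in> F ` l2" by (auto simp: Fsc[symmetric] l2_scale)
  next
    fix f g h assume "f \<in> F ` l2" "g \<in> F ` l2" "h \<in> F ` l2"
    then show "ip (f + g) h = ip f h + ip g h"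
      by (auto simp: Fadd[symmetric] l2_add ipF algebra_simps suminf_add l2_prod l2_cnj)
  next
    fix f h c assume "f \<in> F ` l2" "h \<in> F ` l2"
    then show "ip (\<lambda>x. c * f x) h = c * ip f h"
      by (auto simp: Fsc[symmetric] l2_scale ipF mult.assoc suminf_mult l2_prod l2_cnj)
  next
    fix f g assume "f \<in> F ` l2" "g \<in> F ` l2"
    then obtain a b where ab: "f = F a" "g = F b" "a \<in> l2" "b \<in> l2" by blast
    have "(\<lambda>n. a n * cnj (b n)) sums ip f g"
      using ab by (simp add: ipF summable_sums l2_prod l2_cnj)
    then have "(\<lambda>n. cnj (a n * cnj (b n))) sums cnj (ip f g)" by (simp only: sums_cnj)
    then show "ip g f = cnj (ip f g)" using ab by (simp add: ipF sums_iff mult.commute)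
  next
    fix f assume "f \<in> F ` l2" "f \<noteq> 0"
    then obtain a where a: "f = F a" "a \<in> l2" by blast
    have "F (\<lambda>n. 0) = 0" by (simp add: F_def fun_eq_iff)
    then have "a \<noteq> (\<lambda>n. 0)" using a \<open>f \<noteq> 0\<close> by metis
    then obtain i where i: "a i \<noteq> 0" by auto
    have "0 < l2_sq a" unfolding l2_sq_def
      by (rule suminf_pos2[where i = i]) (use a i in \<open>auto simp: l2_def\<close>)
    then show "0 < Re (ip f f)" using a by (simp add: ipn)
  next
    fix u assume u: "\<And>n::nat. u n \<in> F ` l2"
      and C: "\<And>\<epsilon>. 0 < \<epsilon> \<Longrightarrow> \<exists>N. \<forall>m\<ge>N. \<forall>n\<ge>N. ip_norm ip (u m - u n) < \<epsilon>"
    from u have "\<exists>b. u n = F b \<and> b \<in> l2" for n by blast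
    then obtain v where v: "\<And>n. u n = F (v n)" "\<And>n. v n \<in> l2" by metis
    obtain b where "b \<in> l2" "(\<lambda>k. sqrt (l2_sq (\<lambda>i. v k i - b i))) \<longlonglongrightarrow> 0"
      using l2_complete[of v] v C by (auto simp: nrm)
    then show "\<exists>f\<in>F ` l2. (\<lambda>n. ip_norm ip (u n - f)) \<longlonglongrightarrow> 0"
      by (auto simp: v nrm)
  next
    fix y show "(\<lambda>x. \<Sum>n. cnj (e y n) * e x n) \<in> F ` l2"
      by (rule image_eqI[of _ _ "\<lambda>n. cnj (e y n)"]) (auto simp: F_def l2_cnj e)
  next
    fix f y assume "f \<in> F ` l2"
    then obtain a where a: "f = F a" "a \<in> l2" by blast
    have "(\<lambda>x. \<Sum>n. cnj (e y n) * e x n) = F (\<lambda>n. cnj (e y n))" by (simp add: F_def)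
    then have "ip f (\<lambda>x. \<Sum>n. cnj (e y n) * e x n) = (\<Sum>n. a n * e y n)"
      using a by (simp add: ipF l2_cnj e)
    then show "f y = ip f (\<lambda>x. \<Sum>n. cnj (e y n) * e x n)" using a by (simp add: F_def)
  qed
  then show ?thesis by blast
qed

lemma powser_disc_eq_0:
  fixes a :: "nat \<Rightarrow> complex"
  assumes "\<And>z. norm z < 1 \<Longrightarrow> (\<lambda>n. a n * z ^ n) sums 0"
  shows "a n = 0"
proof -
  have cr: "fps_conv_radius (Abs_fps a) \<ge> 1"
    unfolding fps_conv_radius_def
    by (rule conv_radius_geI_ex') (use assms in \<open>auto simp: sums_iff\<close>)
  have "Abs_fps a = 0"
  proof (rule eval_fps_eqD)
    show "0 < fps_conv_radius (Abs_fps a)" by (rule less_le_trans[OF _ cr]) simp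
    have "\<forall>\<^sub>F z::complex in nhds 0. norm z < 1"
      using eventually_nhds_in_open[of "ball 0 1" "0::complex"] by (simp add: dist_norm)
    then show "\<forall>\<^sub>F z in nhds 0. eval_fps (Abs_fps a) z = eval_fps 0 z"
    proof eventually_elim
      case (elim z)
      show ?case using sums_unique[OF assms[OF elim]] by (simp add: eval_fps_def)
    qed
  qed auto
  then show ?thesis by (metis fps_nth_Abs_fps fps_zero_nth)
qed

lemma wt_le: assumes "s \<le> 0" shows "real (n + 1) powr s \<le> 1"
  using powr_mono[of s 0 "real (n+1)"] assms by simp

theorem ex_rkhs_K_disc: "s \<le> 0 \<Longrightarrow> \<exists>H ip. rkhs H ip (K_disc s)"
proof -
  assume s: "s \<le> 0"
  define r where "r n = sqrt (real (n + 1) powr s)" for n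
  define e where "e x n = of_real (r n) * Rep_disc x ^ n" for x n
  have r: "0 < r n" "r n \<le> 1" "(r n)\<^sup>2 = real (n + 1) powr s" for n
    using wt_le[OF s] by (auto simp: r_def)
  have e: "e x \<in> l2" for x
    unfolding l2_def mem_Collect_eq
  proof (rule summable_comparison_test)
    have x: "norm (Rep_disc x) < 1" using Rep_disc by blast
    then have "norm ((norm (Rep_disc x))\<^sup>2) < 1" by (simp add: power_less_one_iff abs_square_less_1)
    then show "summable (\<lambda>n. ((norm (Rep_disc x))\<^sup>2) ^ n)" by (rule summable_geometric)
    have "norm ((norm (e x n))\<^sup>2) \<le> ((norm (Rep_disc x))\<^sup>2) ^ n" for n
    proof -
      have "(norm (e x n))\<^sup>2 = (r n)\<^sup>2 * ((norm (Rep_disc x))\<^sup>2) ^ n"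
        using r(1)[of n]
        by (simp add: e_def norm_mult norm_power power_mult_distrib power_mult[symmetric] mult.commute)
      also have "\<dots> \<le> 1 * ((norm (Rep_disc x))\<^sup>2) ^ n"
        by (rule mult_right_mono) (use wt_le[OF s, of n] in \<open>simp_all only: r(3) zero_le_power zero_le_power2\<close>)
      finally show ?thesis by simp
    qed
    then show "\<exists>N. \<forall>n\<ge>N. norm ((norm (e x n))\<^sup>2) \<le> ((norm (Rep_disc x))\<^sup>2) ^ n" by blast
  qed
  have "\<exists>H ip. rkhs H ip (\<lambda>x y. \<Sum>n. cnj (e y n) * e x n)"
  proof (rule rkhs_of_features[OF e])
    fix b assume b: "b \<in> l2" "\<And>x. (\<Sum>n. b n * e x n) = 0"
    have "b n * of_real (r n) = 0" for n
    proof (rule powser_disc_eq_0[of "\<lambda>n. b n * of_real (r n)"])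
      fix z :: complex assume "norm z < 1"
      then have z: "Rep_disc (Abs_disc z) = z" by (simp add: Abs_disc_inverse)
      have "(\<lambda>n. b n * e (Abs_disc z) n) sums 0"
        using l2_prod[OF b(1) e] b(2) by (metis summable_sums)
      then show "(\<lambda>n. b n * of_real (r n) * z ^ n) sums 0"
        by (simp add: e_def z mult.assoc)
    qed
    then show "b = (\<lambda>n. 0)" using r(1) by (auto simp: fun_eq_iff less_imp_neq[symmetric])
  qed
  moreover have "(\<lambda>x y. \<Sum>n. cnj (e y n) * e x n) = K_disc s"
  proof -
    have "cnj (e y n) * e x n = of_real (real (n + 1) powr s) * (Rep_disc x * cnj (Rep_disc y)) ^ n" for x y n
      unfolding r(3)[symmetric] e_def by (simp add: power2_eq_square power_mult_distrib mult_ac)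
    then show ?thesis by (simp add: K_disc_def fun_eq_iff)
  qed
  ultimately show ?thesis by simp
qed

end

theory Submission
  imports Defs "HOL-Complex_Analysis.Conformal_Mappings" "HOL-Real_Asymp.Real_Asymp"
begin

text \<open>
  Write \<open>M\<^sub>s\<close> for the multiplier algebra of \<open>H\<^sub>s\<close>.  The monomials \<open>z\<^sup>n\<close> are orthogonal in \<open>H\<^sub>s\<close> and
  the square of the norm of \<open>z\<^sup>n\<close> is \<open>v n = (n + 1) powr (- s)\<close>, so \<open>H\<^sub>s\<close> consists of the power
  series with square summable coefficients with respect to the weight \<open>v\<close>
  (\<open>zpow_mem_orth\<close>, \<open>coef_sums\<close>, \<open>Parseval\<close>, \<open>mem_of_coefficients\<close>).  As \<open>s \<le> 0\<close>, this weight is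
  nondecreasing and submultiplicative: the backward shift is a contraction of \<open>H\<^sub>s\<close>, and
  multiplication by \<open>z\<^sup>n\<close> has norm at most \<open>sqrt (v n)\<close>, which grows only polynomially.

  The first step is that an algebra isomorphism \<open>\<phi>\<close> from \<open>M\<^sub>s\<close> to \<open>M\<^sub>t\<close> is composition with a
  holomorphic map of the disc (\<open>iso_is_composition\<close>).  The map is \<open>\<theta> = \<phi> z\<close>.  For \<open>1 < norm c\<close> the
  function \<open>z - c\<close> is invertible in \<open>M\<^sub>s\<close>, so its image \<open>\<theta> - c\<close> has no zero; hence \<open>norm \<theta> \<le> 1\<close>,
  and the inequality is strict by the open mapping theorem.  For \<open>f\<close> in \<open>M\<^sub>s\<close> and a point \<open>\<mu>\<close> of the
  disc, \<open>f - f \<mu>\<close> is divisible by \<open>z - \<mu>\<close> in \<open>M\<^sub>s\<close>; evaluating the image of this factorization at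
  \<open>y\<close> with \<open>\<mu> = \<theta> y\<close> gives \<open>\<phi> f y = f (\<theta> y)\<close>.  The same applies to
  the inverse of \<open>\<phi>\<close>, so \<open>\<theta>\<close> has a holomorphic inverse \<open>\<theta>'\<close>.

  The second step replaces \<open>\<theta>\<close> by a rotation (\<open>Mult_eq_of_algebra_iso\<close>).  Both algebras are
  invariant under rotations, so for rotations \<open>R\<close> and \<open>R'\<close> composition with
  \<open>\<theta> \<circ> R \<circ> \<theta>' \<circ> R' \<circ> \<theta>\<close> also maps \<open>M\<^sub>s\<close> onto \<open>M\<^sub>t\<close>.  By the maximum modulus principle and the
  intermediate value theorem the rotations can be chosen such that this automorphism fixes the
  origin (\<open>exists_equimodular_point\<close>); by the Schwarz lemma it is then a rotation, and
  \<open>M\<^sub>s = M\<^sub>t\<close> as sets of functions.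

  Finally these sets differ when \<open>s < t\<close> (\<open>Mult_neq\<close>): a lacunary series
  \<open>\<Sum>k. c\<^sub>k z^(N k)\<close> whose coefficients are chosen so that it converges in the multiplier norm of
  \<open>M\<^sub>t\<close> does not belong to \<open>H\<^sub>s\<close> if the exponents \<open>N k\<close> grow fast enough.
\<close>

section \<open>Norm convergence in a reproducing kernel Hilbert space\<close>

lemma sum_fun_apply: "(\<Sum>i\<in>A. u i) x = (\<Sum>i\<in>A. u i x)"
  by (induction A rule: infinite_finite_induct) auto

context rkhs
begin

abbreviation nrm :: "('x \<Rightarrow> complex) \<Rightarrow> real" where "nrm \<equiv> ip_norm ip"

lemma diff_mem: "f \<in> H \<Longrightarrow> g \<in> H \<Longrightarrow> f - g \<in> H"
proof -
  assume fg: "f \<in> H" "g \<in> H"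
  have "f - g = f + (\<lambda>x. (-1) * g x)" by (auto simp: fun_eq_iff)
  then show ?thesis using fg add_mem scale_mem by metis
qed

lemma sum_mem: "(\<And>i. i \<in> A \<Longrightarrow> u i \<in> H) \<Longrightarrow> (\<Sum>i\<in>A. u i) \<in> H"
  by (induction A rule: infinite_finite_induct) (auto simp: zero_mem add_mem)

lemma ip_diff_left: "f \<in> H \<Longrightarrow> g \<in> H \<Longrightarrow> h \<in> H \<Longrightarrow> ip (f - g) h = ip f h - ip g h"
  using ip_add_left[of "f - g" g h] diff_mem by simp

lemma ip_zero_left: "h \<in> H \<Longrightarrow> ip 0 h = 0"
  using ip_diff_left[of 0 0 h] zero_mem by simp

lemma ip_sum_left:
  "(\<And>i. i \<in> A \<Longrightarrow> u i \<in> H) \<Longrightarrow> h \<in> H \<Longrightarrow> ip (\<Sum>i\<in>A. u i) h = (\<Sum>i\<in>A. ip (u i) h)"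
  by (induction A rule: infinite_finite_induct) (auto simp: ip_zero_left ip_add_left sum_mem)

lemma ip_scale_right: "f \<in> H \<Longrightarrow> h \<in> H \<Longrightarrow> ip h (\<lambda>x. c * f x) = cnj c * ip h f"
  using ip_commute[of "\<lambda>x. c * f x" h] ip_commute[of f h] ip_scale_left[of f h c] scale_mem[of f c]
  by simp

lemma ip_diff_right: "f \<in> H \<Longrightarrow> g \<in> H \<Longrightarrow> h \<in> H \<Longrightarrow> ip h (f - g) = ip h f - ip h g"
  using ip_commute[of "f - g" h] ip_commute[of f h] ip_commute[of g h] ip_diff_left[of f g h] diff_mem[of f g]
  by simp

lemma ip_sum_right:
  assumes "\<And>i. i \<in> A \<Longrightarrow> u i \<in> H" "h \<in> H"
  shows "ip h (\<Sum>i\<in>A. u i) = (\<Sum>i\<in>A. ip h (u i))"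
proof -
  have 1: "ip h (sum u A) = cnj (ip (sum u A) h)"
    by (rule ip_commute) (use sum_mem[of A u] assms in auto)
  have 2: "ip (sum u A) h = (\<Sum>i\<in>A. ip (u i) h)"
    using ip_sum_left[of A u h] assms by auto
  have 3: "cnj (ip (u i) h) = ip h (u i)" if "i \<in> A" for i
    using ip_commute[of "u i" h] assms that by auto
  show ?thesis unfolding 1 2 cnj_sum by (rule sum.cong) (auto simp: 3)
qed

lemma Re_ip_nonneg: "f \<in> H \<Longrightarrow> 0 \<le> Re (ip f f)"
  using ip_pos[of f] ip_zero_left[OF zero_mem] by (cases "f = 0") auto

lemma nrm_nonneg: "f \<in> H \<Longrightarrow> 0 \<le> nrm f"
  unfolding ip_norm_def by (simp add: Re_ip_nonneg)

lemma nrm_sq: "f \<in> H \<Longrightarrow> (nrm f)\<^sup>2 = Re (ip f f)"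
  unfolding ip_norm_def by (simp add: Re_ip_nonneg)

lemma ip_self: "f \<in> H \<Longrightarrow> ip f f = of_real ((nrm f)\<^sup>2)"
  using ip_commute[of f f] by (simp add: nrm_sq complex_eq_iff)

lemma nrm_scale:
  assumes "f \<in> H" shows "nrm (\<lambda>x. c * f x) = norm c * nrm f"
proof -
  have "ip (\<lambda>x. c * f x) (\<lambda>x. c * f x) = c * cnj c * ip f f"
    using assms by (simp add: scale_mem ip_scale_left ip_scale_right)
  then have "complex_of_real ((nrm (\<lambda>x. c * f x))\<^sup>2) = of_real ((norm c * nrm f)\<^sup>2)"
    using assms by (simp add: ip_self scale_mem power_mult_distrib complex_norm_square del: of_real_power)
  then have "(nrm (\<lambda>x. c * f x))\<^sup>2 = (norm c * nrm f)\<^sup>2"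
    by (simp only: of_real_eq_iff)
  then show ?thesis
    using assms by (simp add: nrm_nonneg scale_mem)
qed

text \<open>
  The square of the norm of \<open>f - c g\<close> is nonnegative; \<open>c\<close> is chosen to minimize it.
\<close>

lemma Cauchy_Schwarz:
  assumes f: "f \<in> H" and g: "g \<in> H"
  shows "norm (ip f g) \<le> nrm f * nrm g"
proof (cases "g = 0")
  case True
  have "ip f g = cnj (ip g f)" by (rule ip_commute[OF g f])
  also have "ip g f = 0" unfolding True by (rule ip_zero_left[OF f])
  finally have "ip f g = 0" by simp
  then show ?thesis using f g by (simp add: nrm_nonneg)
next
  case False
  define N where "N = (nrm g)\<^sup>2"
  have N: "0 < N" using ip_pos[OF g False] g by (simp add: nrm_sq N_def)
  define c where "c = ip f g / of_real N"
  define h where "h = f - (\<lambda>x. c * g x)"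
  have cg: "(\<lambda>x. c * g x) \<in> H" using g by (rule scale_mem)
  have gf: "ip g f = cnj (ip f g)" by (rule ip_commute[OF f g])
  have "ip h h = ip f f - cnj c * ip f g - c * ip g f + c * cnj c * ip g g"
    unfolding h_def using f g cg
    by (simp add: ip_diff_left ip_diff_right diff_mem ip_scale_left ip_scale_right algebra_simps)
  also have "ip g g = of_real N" using g by (simp add: ip_self N_def)
  also have "ip f f - cnj c * ip f g - c * ip g f + c * cnj c * of_real N
      = of_real ((nrm f)\<^sup>2 - (norm (ip f g))\<^sup>2 / N)"
    using N f by (simp add: c_def gf ip_self complex_norm_square divide_simps del: of_real_power)
  finally have "0 \<le> (nrm f)\<^sup>2 - (norm (ip f g))\<^sup>2 / N"
    using Re_ip_nonneg[OF diff_mem[OF f cg]] by (simp only: h_def Re_complex_of_real)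
  then have "(norm (ip f g))\<^sup>2 \<le> (nrm f * nrm g)\<^sup>2"
    using N by (simp add: field_simps power_mult_distrib N_def)
  then show ?thesis
    by (rule power2_le_imp_le) (simp add: f g nrm_nonneg)
qed

lemma nrm_triangle:
  assumes f: "f \<in> H" and g: "g \<in> H"
  shows "nrm (f + g) \<le> nrm f + nrm g"
proof -
  have 1: "ip h (f + g) = ip h f + ip h g" if "h \<in> H" for h
    using ip_commute[of "f + g" h] ip_commute[of f h] ip_commute[of g h] f g that
    by (simp add: ip_add_left add_mem)
  have "(nrm (f + g))\<^sup>2 = Re (ip f f + ip g g + (ip f g + ip g f))"
    using f g by (simp add: nrm_sq add_mem ip_add_left 1)
  also have "ip f g + ip g f = of_real (2 * Re (ip f g))"
    using ip_commute[OF f g] by (simp add: complex_add_cnj)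
  also have "Re (ip f f + ip g g + of_real (2 * Re (ip f g))) \<le> (nrm f)\<^sup>2 + (nrm g)\<^sup>2 + 2 * (nrm f * nrm g)"
    using Cauchy_Schwarz[OF f g] complex_Re_le_cmod[of "ip f g"] f g by (simp add: nrm_sq)
  also have "\<dots> = (nrm f + nrm g)\<^sup>2" by (simp add: power2_sum)
  finally show ?thesis
    by (rule power2_le_imp_le) (simp add: f g nrm_nonneg)
qed

lemma nrm_zero: "nrm 0 = 0"
  by (simp add: ip_norm_def ip_zero_left zero_mem)

lemma nrm_sum_le: "(\<And>i. i \<in> A \<Longrightarrow> u i \<in> H) \<Longrightarrow> nrm (\<Sum>i\<in>A. u i) \<le> (\<Sum>i\<in>A. nrm (u i))"
proof (induction A rule: infinite_finite_induct)
  case (insert x A)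
  then have "nrm (u x + (\<Sum>i\<in>A. u i)) \<le> nrm (u x) + nrm (\<Sum>i\<in>A. u i)"
    by (intro nrm_triangle sum_mem) auto
  also have "\<dots> \<le> nrm (u x) + (\<Sum>i\<in>A. nrm (u i))" using insert by simp
  finally show ?case unfolding sum.insert[OF insert.hyps] .
qed (auto simp: nrm_zero)

lemma nrm_diff_commute: "f \<in> H \<Longrightarrow> g \<in> H \<Longrightarrow> nrm (f - g) = nrm (g - f)"
  using nrm_scale[OF diff_mem, of f g "-1"] by (simp add: fun_diff_def)

lemma norm_limit_ip:
  assumes "\<And>n. u n \<in> H" "f \<in> H" "(\<lambda>n. nrm (u n - f)) \<longlonglongrightarrow> 0" "h \<in> H"
  shows "(\<lambda>n. ip (u n) h) \<longlonglongrightarrow> ip f h"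
proof (rule Lim_null_comparison[of _ "\<lambda>n. nrm (u n - f) * nrm h", THEN LIM_zero_cancel])
  show "(\<lambda>n. nrm (u n - f) * nrm h) \<longlonglongrightarrow> 0" using tendsto_mult_right[OF assms(3), of "nrm h"] by simp
  have "norm (ip (u n) h - ip f h) \<le> nrm (u n - f) * nrm h" for n
    using Cauchy_Schwarz[of "u n - f" h] assms by (simp add: diff_mem ip_diff_left)
  then show "\<forall>\<^sub>F n in sequentially. norm (ip (u n) h - ip f h) \<le> nrm (u n - f) * nrm h" by simp
qed

text \<open>
  Evaluation at \<open>x\<close> is the inner product with the kernel function at \<open>x\<close>, hence continuous.
\<close>

lemma norm_limit_pointwise:
  assumes "\<And>n. u n \<in> H" "f \<in> H" "(\<lambda>n. nrm (u n - f)) \<longlonglongrightarrow> 0"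
  shows "(\<lambda>n. u n x) \<longlonglongrightarrow> f x"
  using norm_limit_ip[OF assms kernel_mem[of x]] by (simp add: reproducing[symmetric] assms)

lemma norm_limit_nrm:
  assumes "\<And>n. u n \<in> H" "f \<in> H" "(\<lambda>n. nrm (u n - f)) \<longlonglongrightarrow> 0"
  shows "(\<lambda>n. nrm (u n)) \<longlonglongrightarrow> nrm f"
proof (rule Lim_null_comparison[of _ "\<lambda>n. nrm (u n - f)", THEN LIM_zero_cancel])
  have "norm (nrm (u n) - nrm f) \<le> nrm (u n - f)" for n
    using nrm_triangle[of "u n - f" f] nrm_triangle[of "f - u n" "u n"] assms
    by (simp add: diff_mem nrm_diff_commute[of f])
  then show "\<forall>\<^sub>F n in sequentially. norm (nrm (u n) - nrm f) \<le> nrm (u n - f)" by simp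
qed (use assms in auto)

lemma partial_sums_converge:
  assumes u: "\<And>n. u n \<in> H"
    and C: "\<And>e. 0 < e \<Longrightarrow> \<exists>N. \<forall>n\<ge>N. \<forall>m\<ge>n. nrm (\<Sum>i=n..<m. u i) < e"
  shows "\<exists>f\<in>H. (\<lambda>n. nrm ((\<Sum>i<n. u i) - f)) \<longlonglongrightarrow> 0"
proof (rule complete)
  show U: "(\<Sum>i<n. u i) \<in> H" for n using u by (auto intro: sum_mem)
  have eq: "(\<Sum>i<m. u i) - (\<Sum>i<n. u i) = (\<Sum>i=n..<m. u i)" if "n \<le> m" for m n
    using sum_diff_nat_ivl[of 0 n m u] that by (simp add: atLeast0LessThan)
  fix e :: real assume "0 < e"
  then obtain N where N: "\<And>m n. n \<ge> N \<Longrightarrow> m \<ge> n \<Longrightarrow> nrm (\<Sum>i=n..<m. u i) < e"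
    using C by blast
  have "nrm ((\<Sum>i<m. u i) - (\<Sum>i<n. u i)) < e" if mn: "m \<ge> N" "n \<ge> N" for m n
  proof (cases "n \<le> m")
    case True
    show ?thesis unfolding eq[OF True] by (rule N[OF mn(2) True])
  next
    case False
    then have "n \<ge> m" by simp
    show ?thesis unfolding nrm_diff_commute[OF U U, of m n] eq[OF \<open>n \<ge> m\<close>]
      by (rule N[OF mn(1) \<open>n \<ge> m\<close>])
  qed
  then show "\<exists>N. \<forall>m\<ge>N. \<forall>n\<ge>N. nrm ((\<Sum>i<m. u i) - (\<Sum>i<n. u i)) < e" by blast
qed

text \<open>
  Absolutely convergent series are the tool for producing new elements of \<open>H\<close>, and thereby
  multipliers: the sum is automatically the pointwise sum.
\<close>

lemma norm_summable:
  assumes u: "\<And>n. u n \<in> H" and S: "summable (\<lambda>n. nrm (u n))"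
  obtains f where "f \<in> H" "\<And>x. (\<lambda>n. u n x) sums f x" "\<And>h. h \<in> H \<Longrightarrow> (\<lambda>n. ip (u n) h) sums ip f h"
proof -
  have U: "(\<Sum>i<n. u i) \<in> H" for n using u by (auto intro: sum_mem)
  have "\<exists>f\<in>H. (\<lambda>n. nrm ((\<Sum>i<n. u i) - f)) \<longlonglongrightarrow> 0"
  proof (rule partial_sums_converge[OF u])
    fix e :: real assume "0 < e"
    then obtain N where N: "\<And>m n. n \<ge> N \<Longrightarrow> norm (\<Sum>i=n..<m. nrm (u i)) < e"
      using S unfolding summable_Cauchy by blast
    have "nrm (\<Sum>i=n..<m. u i) < e" if "n \<ge> N" for m n
      using nrm_sum_le[of "{n..<m}" u] u N[OF that, of m] by simp
    then show "\<exists>N. \<forall>n\<ge>N. \<forall>m\<ge>n. nrm (\<Sum>i=n..<m. u i) < e" by blast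
  qed
  then obtain f where f: "f \<in> H" "(\<lambda>n. nrm ((\<Sum>i<n. u i) - f)) \<longlonglongrightarrow> 0" by blast
  have "(\<lambda>n. u n x) sums f x" for x
    using norm_limit_pointwise[OF U f, of x] by (simp add: sums_def sum_fun_apply)
  moreover have "(\<lambda>n. ip (u n) h) sums ip f h" if "h \<in> H" for h
    using norm_limit_ip[OF U f that] u that by (simp add: sums_def ip_sum_left)
  ultimately show ?thesis using that f by blast
qed

end

section \<open>Monomials in the space\<close>

lemma norm_Rep_disc: "norm (Rep_disc x) < 1"
  using Rep_disc by blast

lemma Rep_Abs_disc: "norm z < 1 \<Longrightarrow> Rep_disc (Abs_disc z) = z"
  by (simp add: Abs_disc_inverse)

definition zpow :: "nat \<Rightarrow> disc \<Rightarrow> complex" where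
  "zpow n x = Rep_disc x ^ n"

locale disc_space = rkhs H ip "K_disc s" for H ip s +
  assumes s_nonpos: "s \<le> 0"
begin

text \<open>
  The reciprocals of the coefficients of the kernel; \<open>v n\<close> turns out to be the square of the norm
  of \<open>z\<^sup>n\<close>.
\<close>

definition v :: "nat \<Rightarrow> real" where
  "v n = real (n + 1) powr (- s)"

lemma v_pos: "0 < v n" by (simp add: v_def)

lemma v_ge_1: "1 \<le> v n"
  using s_nonpos by (auto simp: v_def intro!: ge_one_powr_ge_zero)

lemma v_mono: "m \<le> n \<Longrightarrow> v m \<le> v n"
  using s_nonpos by (auto simp: v_def intro!: powr_mono2)

lemma v_submult: "v (m + n) \<le> v m * v n"
proof -
  have "real (m + n + 1) \<le> real (m + 1) * real (n + 1)" by (simp add: algebra_simps)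
  then have "real (m + n + 1) powr (-s) \<le> (real (m + 1) * real (n + 1)) powr (-s)"
    using s_nonpos by (intro powr_mono2) auto
  also have "\<dots> = real (m + 1) powr (-s) * real (n + 1) powr (-s)"
    by (rule powr_mult)
  finally show ?thesis unfolding v_def .
qed

lemma wt_eq: "real (n + 1) powr s = inverse (v n)"
  by (simp add: v_def powr_minus)

lemma summable_tail_kernel:
  assumes "norm \<zeta> < 1"
  shows "summable (\<lambda>m. complex_of_real (inverse (v (n + m))) * \<zeta> ^ m)"
proof (rule summable_comparison_test')
  show "summable (\<lambda>m. norm \<zeta> ^ m)" using assms by (simp add: summable_geometric)
  show "norm (complex_of_real (inverse (v (n + m))) * \<zeta> ^ m) \<le> norm \<zeta> ^ m" for m
    using v_pos[of "n + m"] v_ge_1[of "n + m"]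
    by (simp add: norm_mult norm_power norm_inverse mult_left_le_one_le inverse_le_1_iff)
qed

text \<open>
  With \<open>\<zeta> = z * cnj w\<close>, the kernel without its first \<open>n\<close> terms is \<open>\<zeta> ^ n * tail_kernel n \<zeta>\<close>.
\<close>

definition tail_kernel :: "nat \<Rightarrow> complex \<Rightarrow> complex" where
  "tail_kernel n \<zeta> = (\<Sum>m. of_real (inverse (v (n + m))) * \<zeta> ^ m)"

lemma tail_kernel_0: "tail_kernel n 0 = of_real (inverse (v n))"
  unfolding tail_kernel_def by (subst powser_zero) simp

lemma tail_kernel_cont: "isCont (tail_kernel n) 0"
proof -
  have "isCont (\<lambda>\<zeta>. \<Sum>m. of_real (inverse (v (n + m))) * \<zeta> ^ m) (0::complex)"
    by (rule isCont_powser[OF summable_tail_kernel[of "1/2"]]) simp_all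
  then show ?thesis by (simp add: tail_kernel_def[abs_def])
qed

lemma kernel_sums:
  "(\<lambda>n. of_real (inverse (v n)) * (Rep_disc z * cnj (Rep_disc w)) ^ n) sums K_disc s z w"
proof -
  have "norm (Rep_disc z * cnj (Rep_disc w)) < 1"
    using norm_Rep_disc[of z] norm_Rep_disc[of w] mult_strict_mono[of "norm (Rep_disc z)" 1 "norm (Rep_disc w)" 1]
    by (simp add: norm_mult)
  from summable_sums[OF summable_tail_kernel[OF this, of 0]] show ?thesis
    unfolding K_disc_def wt_eq by simp
qed

lemma kernel_split:
  "K_disc s z w - (\<Sum>k<n. of_real (inverse (v k)) * (Rep_disc z * cnj (Rep_disc w)) ^ k)
     = (Rep_disc z * cnj (Rep_disc w)) ^ n * tail_kernel n (Rep_disc z * cnj (Rep_disc w))"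
  (is "_ = ?c ^ n * _")
proof -
  have c: "norm ?c < 1"
    using norm_Rep_disc[of z] norm_Rep_disc[of w] mult_strict_mono[of "norm (Rep_disc z)" 1 "norm (Rep_disc w)" 1]
    by (simp add: norm_mult)
  have "K_disc s z w = (\<Sum>m. of_real (inverse (v m)) * ?c ^ m)"
    using kernel_sums by (simp add: sums_iff)
  also have "\<dots> = (\<Sum>m. of_real (inverse (v (m + n))) * ?c ^ (m + n)) + (\<Sum>k<n. of_real (inverse (v k)) * ?c ^ k)"
    using summable_tail_kernel[OF c, of 0] by (intro suminf_split_initial_segment) simp
  also have "(\<Sum>m. of_real (inverse (v (m + n))) * ?c ^ (m + n)) = ?c ^ n * tail_kernel n ?c"
    unfolding tail_kernel_def
    by (subst suminf_mult[symmetric, OF summable_tail_kernel[OF c]])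
       (simp add: power_add mult_ac add.commute)
  finally show ?thesis by simp
qed

text \<open>
  Subtracting from the kernel function at a small real point \<open>r\<close> its terms of degree below \<open>n\<close>
  leaves a function that is orthogonal to the lower monomials, and
  that becomes \<open>z\<^sup>n * tail_kernel n (r z)\<close> after division by \<open>r ^ n\<close>.  All inner products between
  these functions are values of \<open>tail_kernel n\<close> near the origin, where it is continuous; so
  they form a Cauchy sequence as \<open>r\<close> tends to \<open>0\<close>, and its limit is a multiple of \<open>z\<^sup>n\<close>.
\<close>

lemma zpow_step:
  assumes memk: "\<And>k. k < n \<Longrightarrow> zpow k \<in> H"
    and orth: "\<And>j k. j < n \<Longrightarrow> k < n \<Longrightarrow> ip (zpow j) (zpow k) = (if j = k then of_real (v k) else 0)"
  shows "zpow n \<in> H" "ip (zpow n) (zpow n) = of_real (v n)"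
    "\<And>k. k < n \<Longrightarrow> ip (zpow n) (zpow k) = 0"
proof -
  define r where "r j = inverse (real j + 2)" for j
  have r: "0 < r j" "r j < 1" for j by (auto simp: r_def field_simps)
  have r0: "r \<longlonglongrightarrow> 0" unfolding r_def by real_asymp
  define y where "y j = Abs_disc (of_real (r j))" for j
  have Ry: "Rep_disc (y j) = of_real (r j)" for j
    unfolding y_def using r[of j] by (intro Rep_Abs_disc) simp
  define ker where "ker j = (\<lambda>x. K_disc s x (y j))" for j
  have ker: "ker j \<in> H" for j unfolding ker_def by (rule kernel_mem)
  have ip_ker: "ip f (ker j) = f (y j)" if "f \<in> H" for f j
    unfolding ker_def using reproducing[OF that] by simp
  have ker_ip: "ip (ker j) f = cnj (f (y j))" if "f \<in> H" for f j
    using ip_commute[OF that ker] ip_ker[OF that] by simp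
  define t where "t j k = (\<lambda>x. (of_real (inverse (v k)) * of_real (r j) ^ k) * zpow k x)" for j k
  have t: "t j k \<in> H" if "k < n" for j k unfolding t_def by (rule scale_mem[OF memk[OF that]])
  \<comment> \<open>The component of the kernel function orthogonal to the lower monomials.\<close>
  define p where "p j = ker j - (\<Sum>k<n. t j k)" for j
  have st: "(\<Sum>k<n. t j k) \<in> H" for j by (rule sum_mem) (simp add: t)
  have p: "p j \<in> H" for j unfolding p_def by (rule diff_mem[OF ker st])
  have pv: "p j x = (Rep_disc x * of_real (r j)) ^ n * tail_kernel n (Rep_disc x * of_real (r j))" for j x
    using kernel_split[of x "y j" n]
    by (simp add: p_def ker_def sum_fun_apply t_def zpow_def Ry power_mult_distrib mult_ac)
  have pk: "ip (p j) (zpow k) = 0" if k: "k < n" for j k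
  proof -
    have "ip (p j) (zpow k) = ip (ker j) (zpow k) - (\<Sum>i<n. ip (t j i) (zpow k))"
      unfolding p_def using ip_diff_left[OF ker st memk[OF k]] ip_sum_left[of "{..<n}" "t j" "zpow k"]
        t memk[OF k] by auto
    also have "(\<Sum>i<n. ip (t j i) (zpow k)) = (\<Sum>i<n. if i = k then of_real (r j) ^ k else 0)"
    proof (rule sum.cong)
      fix i assume "i \<in> {..<n}"
      then have i: "i < n" by simp
      show "ip (t j i) (zpow k) = (if i = k then of_real (r j) ^ k else 0)"
        unfolding t_def ip_scale_left[OF memk[OF i] memk[OF k]] orth[OF i k]
        using v_pos[of k] by simp
    qed simp
    also have "ip (ker j) (zpow k) = of_real (r j) ^ k"
      unfolding ker_ip[OF memk[OF k]] by (simp add: zpow_def Ry)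
    finally show ?thesis using k by simp
  qed
  have pp: "ip (p i) (p j) = (of_real (r i) * of_real (r j)) ^ n * tail_kernel n (of_real (r i) * of_real (r j))" for i j
  proof -
    have "ip (p i) (p j) = ip (p i) (ker j) - (\<Sum>k<n. ip (p i) (t j k))"
      unfolding p_def[of j] using ip_diff_right[OF ker st p] ip_sum_right[of "{..<n}" "t j" "p i"] t p by auto
    also have "(\<Sum>k<n. ip (p i) (t j k)) = 0"
      by (rule sum.neutral) (auto simp: t_def ip_scale_right memk p pk)
    also have "ip (p i) (ker j) = (of_real (r i) * of_real (r j)) ^ n * tail_kernel n (of_real (r i) * of_real (r j))"
      unfolding ip_ker[OF p] by (simp add: pv Ry mult.commute)
    finally show ?thesis by simp
  qed
  define g where "g j = (\<lambda>x. inverse (of_real (r j) ^ n) * p j x)" for j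
  have g: "g j \<in> H" for j unfolding g_def by (rule scale_mem[OF p])
  have gv: "g j x = Rep_disc x ^ n * tail_kernel n (Rep_disc x * of_real (r j))" for j x
    using r(1)[of j] by (simp add: g_def pv power_mult_distrib)
  have gg: "ip (g i) (g j) = tail_kernel n (of_real (r i) * of_real (r j))" for i j
  proof -
    have "ip (g i) (g j) = inverse (of_real (r i) ^ n) * (cnj (inverse (of_real (r j) ^ n)) * ip (p i) (p j))"
      unfolding g_def by (simp add: ip_scale_left ip_scale_right p scale_mem)
    then show ?thesis using r(1)[of j] r(1)[of i]
      unfolding pp by (simp add: power_mult_distrib field_simps)
  qed
  \<comment> \<open>The square of the norm of \<open>g i - g j\<close> is a sum of four differences of values of the tail kernel.\<close>
  have "\<exists>f\<in>H. (\<lambda>j. nrm (g j - f)) \<longlonglongrightarrow> 0"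
  proof (rule complete[OF g])
    fix e :: real assume e: "0 < e"
    then have "0 < e\<^sup>2 / 4" by simp
    then obtain d where d: "0 < d" "\<And>\<zeta>. norm \<zeta> < d \<Longrightarrow> norm (tail_kernel n \<zeta> - tail_kernel n 0) < e\<^sup>2 / 4"
      using tail_kernel_cont[of n] unfolding isCont_def LIM_def dist_norm
      by (metis diff_zero norm_zero diff_self)
    obtain N where N: "\<And>j. j \<ge> N \<Longrightarrow> r j < d"
      using order_tendstoD(2)[OF r0 d(1)] by (auto simp: eventually_sequentially)
    have "nrm (g i - g j) < e" if ij: "i \<ge> N" "j \<ge> N" for i j
    proof -
      define T where "T a b = tail_kernel n (of_real (r a) * of_real (r b)) - tail_kernel n 0" for a b
      have T: "norm (T a b) < e\<^sup>2 / 4" if "a \<ge> N" for a b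
      proof -
        have "r a * r b < d" using N[OF that] mult_left_mono[of "r b" 1 "r a"] r[of a] r[of b] by linarith
        then show ?thesis unfolding T_def using r[of a] r[of b]
          by (intro d(2)) (simp add: norm_mult)
      qed
      have "(nrm (g i - g j))\<^sup>2 = Re (T i i - T i j - T j i + T j j)"
        using g by (simp add: nrm_sq diff_mem ip_diff_left ip_diff_right gg T_def)
      also have "\<dots> \<le> norm (T i i) + norm (T i j) + norm (T j i) + norm (T j j)"
        using abs_Re_le_cmod[of "T i i"] abs_Re_le_cmod[of "T i j"] abs_Re_le_cmod[of "T j i"]
          abs_Re_le_cmod[of "T j j"] by simp
      also have "\<dots> < e\<^sup>2"
        using T[OF ij(1), of i] T[OF ij(1), of j] T[OF ij(2), of i] T[OF ij(2), of j] by simp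
      finally show ?thesis using e by (simp add: power2_less_imp_less)
    qed
    then show "\<exists>N. \<forall>m\<ge>N. \<forall>n\<ge>N. nrm (g m - g n) < e" by blast
  qed
  then obtain f where f: "f \<in> H" "(\<lambda>j. nrm (g j - f)) \<longlonglongrightarrow> 0" by blast
  have "f x = of_real (inverse (v n)) * zpow n x" for x
  proof (rule LIMSEQ_unique[OF norm_limit_pointwise[OF g f]])
    have "(\<lambda>j. Rep_disc x * of_real (r j)) \<longlonglongrightarrow> Rep_disc x * of_real 0"
      by (intro tendsto_intros r0)
    then have "(\<lambda>j. tail_kernel n (Rep_disc x * of_real (r j))) \<longlonglongrightarrow> tail_kernel n 0"
      by (intro isCont_tendsto_compose[OF tail_kernel_cont]) simp
    then have "(\<lambda>j. g j x) \<longlonglongrightarrow> Rep_disc x ^ n * tail_kernel n 0"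
      unfolding gv by (rule tendsto_mult_left)
    then show "(\<lambda>j. g j x) \<longlonglongrightarrow> of_real (inverse (v n)) * zpow n x"
      by (simp add: tail_kernel_0 zpow_def mult.commute)
  qed
  then have m: "zpow n = (\<lambda>x. of_real (v n) * f x)"
    using v_pos[of n] by (auto simp: fun_eq_iff)
  show mem: "zpow n \<in> H" unfolding m by (rule scale_mem[OF f(1)])
  have ipm: "ip (zpow n) h = of_real (v n) * ip f h" if "h \<in> H" for h
    unfolding m by (rule ip_scale_left[OF f(1) that])
  show mk: "ip (zpow n) (zpow k) = 0" if k: "k < n" for k
  proof -
    have "ip (g j) (zpow k) = 0" for j
      unfolding g_def using p memk[OF k] k by (simp add: ip_scale_left pk)
    then have "ip f (zpow k) = 0"
      using norm_limit_ip[OF g f memk[OF k]] by (simp add: LIMSEQ_const_iff)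
    then show ?thesis using ipm[OF memk[OF k]] by simp
  qed
  have "ip (g j) (zpow n) = 1" for j
  proof -
    have "ip (p j) (zpow n) = ip (ker j) (zpow n) - (\<Sum>i<n. ip (t j i) (zpow n))"
      unfolding p_def using ip_diff_left[OF ker st mem] ip_sum_left[of "{..<n}" "t j" "zpow n"]
        t mem by auto
    also have "(\<Sum>i<n. ip (t j i) (zpow n)) = 0"
    proof (rule sum.neutral, safe)
      fix i assume i: "i < n"
      have "ip (zpow i) (zpow n) = 0" using ip_commute[OF mem memk[OF i]] mk[OF i] by simp
      then show "ip (t j i) (zpow n) = 0" unfolding t_def ip_scale_left[OF memk[OF i] mem] by simp
    qed
    also have "ip (ker j) (zpow n) = of_real (r j) ^ n"
      unfolding ker_ip[OF mem] by (simp add: zpow_def Ry)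
    finally have "ip (p j) (zpow n) = of_real (r j) ^ n" by simp
    then show ?thesis unfolding g_def using p mem r(1)[of j] by (simp add: ip_scale_left)
  qed
  then have "ip f (zpow n) = 1"
    using norm_limit_ip[OF g f mem] by (simp add: LIMSEQ_const_iff)
  then show "ip (zpow n) (zpow n) = of_real (v n)" using ipm[OF mem] by simp
qed

lemma zpow_mem_orth: "zpow n \<in> H \<and> (\<forall>k\<le>n. ip (zpow n) (zpow k) = (if n = k then of_real (v k) else 0))"
proof (induction n rule: less_induct)
  case (less n)
  have mem: "zpow k \<in> H" if "k < n" for k using less[OF that] by blast
  have orth: "ip (zpow j) (zpow k) = (if j = k then of_real (v k) else 0)" if "j < n" "k < n" for j k
  proof (cases "k \<le> j")
    case True
    then show ?thesis using less[OF that(1)] by blast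
  next
    case False
    then have "ip (zpow k) (zpow j) = 0" using less[OF that(2)] by simp
    then show ?thesis using ip_commute[OF mem[OF that(2)] mem[OF that(1)]] False by simp
  qed
  have "zpow n \<in> H" "ip (zpow n) (zpow n) = of_real (v n)"
    "\<And>k. k < n \<Longrightarrow> ip (zpow n) (zpow k) = 0"
    using zpow_step[of n, OF mem orth] by auto
  then show ?case by (auto simp: le_less)
qed

lemma zpow_mem: "zpow n \<in> H" using zpow_mem_orth by blast

lemma zpow_orth: "ip (zpow n) (zpow k) = (if n = k then of_real (v k) else 0)"
proof (cases "k \<le> n")
  case False
  then have "ip (zpow k) (zpow n) = 0" using zpow_mem_orth[of k] by simp
  then show ?thesis using ip_commute[OF zpow_mem zpow_mem, of k n] False by simp
qed (use zpow_mem_orth in blast)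

section \<open>The space as a weighted sequence space\<close>

definition coef :: "(disc \<Rightarrow> complex) \<Rightarrow> nat \<Rightarrow> complex" where
  "coef f n = ip f (zpow n) / of_real (v n)"

lemma nrm_zpow: "nrm (zpow n) = sqrt (v n)"
  unfolding ip_norm_def by (simp add: zpow_orth)

lemma ip_zpow: "ip f (zpow n) = of_real (v n) * coef f n"
  using v_pos[of n] by (simp add: coef_def)

text \<open>
  The kernel function at \<open>x\<close> is the norm convergent sum of its monomial terms.  Taking the inner
  product of \<open>f\<close> with it term by term gives the power series of \<open>f\<close>.
\<close>

lemma coef_sums:
  assumes f: "f \<in> H"
  shows "(\<lambda>n. coef f n * Rep_disc x ^ n) sums f x"
proof -
  define u where "u n = (\<lambda>z. (of_real (inverse (v n)) * cnj (Rep_disc x) ^ n) * zpow n z)" for n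
  have u: "u n \<in> H" for n unfolding u_def by (rule scale_mem[OF zpow_mem])
  have "summable (\<lambda>n. nrm (u n))"
  proof (rule summable_comparison_test')
    show "summable (\<lambda>n. norm (Rep_disc x) ^ n)" using norm_Rep_disc by (simp add: summable_geometric)
    show "norm (nrm (u n)) \<le> norm (Rep_disc x) ^ n" for n
    proof -
      have "nrm (u n) = inverse (v n) * sqrt (v n) * norm (Rep_disc x) ^ n"
        unfolding u_def nrm_scale[OF zpow_mem] nrm_zpow using v_pos[of n]
        by (simp add: norm_mult norm_power norm_inverse)
      also have "\<dots> \<le> 1 * norm (Rep_disc x) ^ n"
      proof (rule mult_right_mono)
        have "sqrt (v n) \<le> v n"
          using v_ge_1[of n] by (intro real_le_lsqrt) (auto simp: power2_eq_square)
        then show "inverse (v n) * sqrt (v n) \<le> 1" using v_pos[of n] by (simp add: field_simps)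
      qed simp
      finally show ?thesis using nrm_nonneg[OF u, of n] by simp
    qed
  qed
  then obtain k where k: "k \<in> H" "\<And>z. (\<lambda>n. u n z) sums k z"
      "\<And>h. h \<in> H \<Longrightarrow> (\<lambda>n. ip (u n) h) sums ip k h"
    using norm_summable[of u] u by blast
  have "k z = K_disc s z x" for z
    using sums_unique2[OF k(2)[of z]] kernel_sums[of z x]
    by (simp add: u_def zpow_def power_mult_distrib mult_ac)
  then have kx: "k = (\<lambda>z. K_disc s z x)" by blast
  have "(\<lambda>n. cnj (ip (u n) f)) sums cnj (ip k f)"
    using k(3)[OF f] by (simp only: sums_cnj)
  also have "cnj (ip k f) = f x"
    using ip_commute[OF k(1) f] reproducing[OF f, of x] kx by simp
  also have "(\<lambda>n. cnj (ip (u n) f)) = (\<lambda>n. coef f n * Rep_disc x ^ n)"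
  proof
    fix n
    have "cnj (ip (u n) f) = ip f (u n)" using ip_commute[OF u f] by simp
    also have "\<dots> = coef f n * Rep_disc x ^ n"
      unfolding u_def ip_scale_right[OF zpow_mem f] ip_zpow using v_pos[of n] by simp
    finally show "cnj (ip (u n) f) = coef f n * Rep_disc x ^ n" .
  qed
  finally show ?thesis .
qed

lemma coef_eqI:
  assumes "f \<in> H" "\<And>x. (\<lambda>n. a n * Rep_disc x ^ n) sums f x"
  shows "coef f = a"
proof
  fix n
  have "a n - coef f n = 0"
  proof (rule powser_disc_eq_0[of "\<lambda>n. a n - coef f n"])
    fix z :: complex assume "norm z < 1"
    then show "(\<lambda>n. (a n - coef f n) * z ^ n) sums 0"
      using sums_diff[OF assms(2)[of "Abs_disc z"] coef_sums[OF assms(1), of "Abs_disc z"]]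
      by (simp add: Rep_Abs_disc algebra_simps)
  qed
  then show "coef f n = a n" by simp
qed

definition wl2 :: "(nat \<Rightarrow> complex) \<Rightarrow> bool" where
  "wl2 a \<longleftrightarrow> summable (\<lambda>n. v n * (norm (a n))\<^sup>2)"

lemma finite_zpow_sum:
  assumes "finite A"
  shows "(nrm (\<Sum>i\<in>A. (\<lambda>x. a i * zpow i x)))\<^sup>2 = (\<Sum>i\<in>A. v i * (norm (a i))\<^sup>2)"
    and "f \<in> H \<Longrightarrow> ip f (\<Sum>i\<in>A. (\<lambda>x. a i * zpow i x)) = (\<Sum>i\<in>A. of_real (v i) * cnj (a i) * coef f i)"
    and "coef (\<Sum>i\<in>A. (\<lambda>x. a i * zpow i x)) n = (if n \<in> A then a n else 0)"
proof -
  let ?P = "\<Sum>i\<in>A. (\<lambda>x. a i * zpow i x)"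
  have t: "(\<lambda>x. a i * zpow i x) \<in> H" for i by (rule scale_mem[OF zpow_mem])
  have P: "?P \<in> H" by (rule sum_mem) (rule t)
  show 1: "ip f ?P = (\<Sum>i\<in>A. of_real (v i) * cnj (a i) * coef f i)" if "f \<in> H" for f
    using ip_sum_right[of A "\<lambda>i x. a i * zpow i x" f] t that
    by (simp add: ip_scale_right zpow_mem ip_zpow mult_ac)
  show 2: "coef ?P n = (if n \<in> A then a n else 0)" for n
  proof -
    have "ip ?P (zpow n) = (\<Sum>i\<in>A. ip (\<lambda>x. a i * zpow i x) (zpow n))"
      using ip_sum_left[of A "\<lambda>i x. a i * zpow i x" "zpow n"] t zpow_mem by blast
    also have "\<dots> = (\<Sum>i\<in>A. if i = n then a n * of_real (v n) else 0)"
      by (rule sum.cong) (auto simp: ip_scale_left zpow_mem zpow_orth)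
    finally show ?thesis using assms v_pos[of n] by (simp add: coef_def)
  qed
  have "complex_of_real ((nrm ?P)\<^sup>2) = of_real (\<Sum>i\<in>A. v i * (norm (a i))\<^sup>2)"
    unfolding ip_self[OF P, symmetric] 1[OF P] of_real_sum
    by (rule sum.cong) (auto simp: 2 complex_norm_square mult_ac simp del: of_real_power)
  then show "(nrm ?P)\<^sup>2 = (\<Sum>i\<in>A. v i * (norm (a i))\<^sup>2)"
    by (simp only: of_real_eq_iff)
qed

text \<open>
  Cauchy-Schwarz for \<open>f\<close> and its own partial sum, whose inner product is the square of the norm of
  the partial sum.
\<close>

lemma Bessel:
  assumes f: "f \<in> H"
  shows "wl2 (coef f)"
  unfolding wl2_def
proof (rule summableI_nonneg_bounded)
  show "0 \<le> v n * (norm (coef f n))\<^sup>2" for n using v_pos[of n] by simp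
  show "(\<Sum>i<n. v i * (norm (coef f i))\<^sup>2) \<le> (nrm f)\<^sup>2" for n
  proof -
    define P where "P = (\<Sum>i<n. (\<lambda>x. coef f i * zpow i x))"
    define S where "S = (\<Sum>i<n. v i * (norm (coef f i))\<^sup>2)"
    have P: "P \<in> H" unfolding P_def by (intro sum_mem scale_mem zpow_mem)
    have PS: "(nrm P)\<^sup>2 = S" unfolding P_def S_def by (rule finite_zpow_sum) simp
    have "ip f P = of_real S"
      unfolding P_def finite_zpow_sum(2)[OF finite_lessThan f] S_def of_real_sum
      by (rule sum.cong) (auto simp: complex_norm_square mult_ac simp del: of_real_power)
    then have "\<bar>S\<bar> \<le> nrm f * nrm P" using Cauchy_Schwarz[OF f P] by simp
    then have "nrm P * nrm P \<le> nrm f * nrm P" using PS by (simp add: power2_eq_square)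
    then have "nrm P \<le> nrm f"
      using nrm_nonneg[OF P] nrm_nonneg[OF f] by (cases "nrm P = 0") auto
    then show ?thesis using power_mono[OF _ nrm_nonneg[OF P], of "nrm f" 2]
      unfolding S_def[symmetric] PS[symmetric] by simp
  qed
qed

lemma ex_of_coefficients:
  assumes a: "wl2 a"
  obtains f where "f \<in> H" "coef f = a" "(nrm f)\<^sup>2 = (\<Sum>n. v n * (norm (a n))\<^sup>2)"
proof -
  define u where "u i = (\<lambda>x. a i * zpow i x)" for i
  have u: "u i \<in> H" for i unfolding u_def by (rule scale_mem[OF zpow_mem])
  have U: "(\<Sum>i<n. u i) \<in> H" for n by (intro sum_mem u)
  have "\<exists>f\<in>H. (\<lambda>n. nrm ((\<Sum>i<n. u i) - f)) \<longlonglongrightarrow> 0"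
  proof (rule partial_sums_converge[OF u])
    fix e :: real assume e: "0 < e"
    then obtain N where N: "\<And>m n. n \<ge> N \<Longrightarrow> norm (\<Sum>i=n..<m. v i * (norm (a i))\<^sup>2) < e\<^sup>2"
      using a unfolding wl2_def summable_Cauchy by (meson zero_less_power)
    have "nrm (\<Sum>i=n..<m. u i) < e" if "n \<ge> N" for m n
    proof -
      have "(nrm (\<Sum>i=n..<m. u i))\<^sup>2 < e\<^sup>2"
        unfolding u_def finite_zpow_sum(1)[OF finite_atLeastLessThan] using N[OF that, of m] by simp
      then show ?thesis using e by (simp add: power2_less_imp_less)
    qed
    then show "\<exists>N. \<forall>n\<ge>N. \<forall>m\<ge>n. nrm (\<Sum>i=n..<m. u i) < e" by blast
  qed
  then obtain f where f: "f \<in> H" "(\<lambda>n. nrm ((\<Sum>i<n. u i) - f)) \<longlonglongrightarrow> 0" by blast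
  have "coef f k = a k" for k
  proof -
    have "(\<lambda>n. coef (\<Sum>i<n. u i) k) \<longlonglongrightarrow> coef f k"
      unfolding coef_def using v_pos[of k] norm_limit_ip[OF U f zpow_mem, of k]
      by (intro tendsto_divide tendsto_const) auto
    moreover have "(\<lambda>n. coef (\<Sum>i<n. u i) k) \<longlonglongrightarrow> a k"
    proof (rule tendsto_eventually, rule eventually_mono[OF eventually_gt_at_top[of k]])
      fix n assume "k < n"
      then show "coef (\<Sum>i<n. u i) k = a k" unfolding u_def finite_zpow_sum(3)[OF finite_lessThan] by simp
    qed
    ultimately show ?thesis by (rule LIMSEQ_unique)
  qed
  moreover have "(nrm f)\<^sup>2 = (\<Sum>n. v n * (norm (a n))\<^sup>2)"
  proof (rule LIMSEQ_unique)
    show "(\<lambda>n. (nrm (\<Sum>i<n. u i))\<^sup>2) \<longlonglongrightarrow> (nrm f)\<^sup>2"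
      by (intro tendsto_intros norm_limit_nrm[OF U f])
    show "(\<lambda>n. (nrm (\<Sum>i<n. u i))\<^sup>2) \<longlonglongrightarrow> (\<Sum>n. v n * (norm (a n))\<^sup>2)"
      unfolding u_def finite_zpow_sum(1)[OF finite_lessThan]
      using summable_LIMSEQ[OF a[unfolded wl2_def]] .
  qed
  ultimately show ?thesis using that f(1) by blast
qed

text \<open>
  The function synthesized from the coefficients of \<open>f\<close> has the same power series as \<open>f\<close>, so it
  is \<open>f\<close>.
\<close>

lemma Parseval:
  assumes f: "f \<in> H"
  shows "(nrm f)\<^sup>2 = (\<Sum>n. v n * (norm (coef f n))\<^sup>2)"
proof -
  obtain g where g: "g \<in> H" "coef g = coef f" "(nrm g)\<^sup>2 = (\<Sum>n. v n * (norm (coef f n))\<^sup>2)"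
    using ex_of_coefficients[OF Bessel[OF f]] by blast
  have "g x = f x" for x
    using sums_unique2[OF coef_sums[OF g(1)], of x] coef_sums[OF f, of x] g(2) by simp
  then have "g = f" by blast
  then show ?thesis using g(3) by simp
qed

lemma mem_of_coefficients:
  assumes a: "wl2 a" and f: "\<And>x. (\<lambda>n. a n * Rep_disc x ^ n) sums f x"
  shows "f \<in> H" "coef f = a"
proof -
  obtain g where g: "g \<in> H" "coef g = a" using ex_of_coefficients[OF a] by blast
  have "g x = f x" for x
    using sums_unique2[OF coef_sums[OF g(1)], of x] f[of x] g(2) by simp
  then have "g = f" by blast
  then show "f \<in> H" "coef f = a" using g by auto
qed

text \<open>
  Operators that act on coefficients are bounded on \<open>H\<close> as soon as they are bounded on the
  weighted sequence space.
\<close>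

lemma nrm_le_of_coefficients:
  assumes "f \<in> H" "\<And>x. (\<lambda>n. b n * Rep_disc x ^ n) sums g x" "wl2 b"
    and "(\<Sum>n. v n * (norm (b n))\<^sup>2) \<le> C\<^sup>2 * (\<Sum>n. v n * (norm (coef f n))\<^sup>2)" "0 \<le> C"
  shows "g \<in> H" "nrm g \<le> C * nrm f"
proof -
  note g = mem_of_coefficients[OF assms(3,2)]
  then show "g \<in> H" by simp
  have "(nrm g)\<^sup>2 \<le> (C * nrm f)\<^sup>2"
    using assms(4) by (simp add: Parseval g assms(1) power_mult_distrib)
  then show "nrm g \<le> C * nrm f"
    by (rule power2_le_imp_le) (simp add: assms nrm_nonneg)
qed

section \<open>Shift operators and multipliers\<close>

lemma mem_holomorphic:
  assumes "f \<in> H"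
  shows "(\<lambda>z. f (Abs_disc z)) holomorphic_on ball 0 1"
proof (rule power_series_holomorphic)
  fix w :: complex assume "w \<in> ball 0 1"
  then show "(\<lambda>n. coef f n * (w - 0) ^ n) sums f (Abs_disc w)"
    using coef_sums[OF assms, of "Abs_disc w"] by (simp add: Rep_Abs_disc)
qed

text \<open>
  Submultiplicativity of \<open>v\<close> bounds the shifted weights.
\<close>

lemma shift:
  assumes f: "f \<in> H"
  shows "zpow n * f \<in> H" "nrm (zpow n * f) \<le> sqrt (v n) * nrm f"
proof -
  define b where "b m = (if m < n then 0 else coef f (m - n))" for m
  have b: "b (m + n) = coef f m" for m by (simp add: b_def)
  have S: "(\<lambda>m. b m * Rep_disc x ^ m) sums (zpow n * f) x" for x
  proof -
    have "(\<lambda>m. Rep_disc x ^ n * (coef f m * Rep_disc x ^ m)) sums (Rep_disc x ^ n * f x)"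
      by (rule sums_mult[OF coef_sums[OF f]])
    then have "(\<lambda>m. b (m + n) * Rep_disc x ^ (m + n)) sums (Rep_disc x ^ n * f x)"
      by (simp add: b power_add mult_ac)
    then show ?thesis
      by (subst (asm) sums_zero_iff_shift) (auto simp: b_def zpow_def)
  qed
  have le: "v (m + n) * (norm (b (m + n)))\<^sup>2 \<le> v n * (v m * (norm (coef f m))\<^sup>2)" for m
    using mult_right_mono[OF v_submult[of m n], of "(norm (coef f m))\<^sup>2"] by (simp add: b mult_ac)
  have sf: "summable (\<lambda>m. v n * (v m * (norm (coef f m))\<^sup>2))"
    using Bessel[OF f] unfolding wl2_def by (rule summable_mult)
  have sb: "summable (\<lambda>m. v (m + n) * (norm (b (m + n)))\<^sup>2)"
    by (rule summable_comparison_test'[OF sf]) (use le v_pos in \<open>simp add: less_imp_le\<close>)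
  then have w: "wl2 b" unfolding wl2_def by (subst (asm) summable_iff_shift)
  have "(\<Sum>m. v m * (norm (b m))\<^sup>2) = (\<Sum>m. v (m + n) * (norm (b (m + n)))\<^sup>2)"
    using suminf_split_initial_segment[OF w[unfolded wl2_def], of n] by (simp add: b_def)
  also have "\<dots> \<le> (\<Sum>m. v n * (v m * (norm (coef f m))\<^sup>2))"
    by (rule suminf_le[OF le sb sf])
  also have "\<dots> = (sqrt (v n))\<^sup>2 * (\<Sum>m. v m * (norm (coef f m))\<^sup>2)"
    using Bessel[OF f] v_pos[of n] by (simp add: suminf_mult wl2_def)
  finally have le': "(\<Sum>m. v m * (norm (b m))\<^sup>2) \<le> (sqrt (v n))\<^sup>2 * (\<Sum>m. v m * (norm (coef f m))\<^sup>2)" .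
  have "0 \<le> sqrt (v n)" using v_pos[of n] by simp
  from nrm_le_of_coefficients[OF f S w le' this]
  show "zpow n * f \<in> H" "nrm (zpow n * f) \<le> sqrt (v n) * nrm f" .
qed

text \<open>
  The backward shift is a contraction because \<open>v\<close> is nondecreasing.
\<close>

lemma backward_shift:
  assumes f: "f \<in> H"
  obtains g where "g \<in> H" "nrm g \<le> nrm f" "\<And>x. f x = coef f 0 + Rep_disc x * g x"
proof -
  define g where "g x = (\<Sum>n. coef f (Suc n) * Rep_disc x ^ n)" for x
  have S: "(\<lambda>n. coef f (Suc n) * Rep_disc x ^ n) sums g x" for x
  proof (cases "Rep_disc x = 0")
    case True
    then show ?thesis unfolding g_def using powser_sums_zero[of "\<lambda>n. coef f (Suc n)"]
      by (simp add: sums_iff)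
  next
    case False
    have "summable (\<lambda>n. coef f (Suc n) * Rep_disc x ^ Suc n)"
      using coef_sums[OF f, of x] by (subst summable_Suc_iff) (simp add: sums_iff)
    then have "summable (\<lambda>n. coef f (Suc n) * Rep_disc x ^ Suc n * inverse (Rep_disc x))"
      by (rule summable_mult2)
    then show ?thesis unfolding g_def using False by (simp add: summable_sums mult_ac)
  qed
  have eq: "f x = coef f 0 + Rep_disc x * g x" for x
  proof -
    have "(\<lambda>n. coef f (Suc n) * Rep_disc x ^ Suc n) sums (Rep_disc x * g x)"
      using sums_mult[OF S[of x], of "Rep_disc x"] by (simp add: mult_ac)
    then have "(\<lambda>n. coef f n * Rep_disc x ^ n) sums (Rep_disc x * g x + coef f 0 * Rep_disc x ^ 0)"
      by (rule sums_Suc)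
    then show ?thesis using sums_unique2[OF coef_sums[OF f]] by (simp add: add.commute)
  qed
  have le: "v n * (norm (coef f (Suc n)))\<^sup>2 \<le> v (Suc n) * (norm (coef f (Suc n)))\<^sup>2" for n
    by (intro mult_right_mono v_mono) auto
  have s1: "summable (\<lambda>n. v (Suc n) * (norm (coef f (Suc n)))\<^sup>2)"
    using Bessel[OF f] unfolding wl2_def by (subst summable_Suc_iff)
  have s2: "summable (\<lambda>n. v n * (norm (coef f (Suc n)))\<^sup>2)"
    by (rule summable_comparison_test'[OF s1]) (use le v_pos in \<open>simp add: less_imp_le\<close>)
  have "(\<Sum>n. v n * (norm (coef f (Suc n)))\<^sup>2) \<le> (\<Sum>n. v (Suc n) * (norm (coef f (Suc n)))\<^sup>2)"
    by (rule suminf_le[OF le s2 s1])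
  also have "\<dots> \<le> 1\<^sup>2 * (\<Sum>n. v n * (norm (coef f n))\<^sup>2)"
    using suminf_split_head[OF Bessel[OF f, unfolded wl2_def]] v_pos[of 0] by simp
  finally show ?thesis
    using nrm_le_of_coefficients[OF f S, of 1] s2 that[of g] eq
    by (simp add: wl2_def)
qed

text \<open>
  With \<open>B\<close> the backward shift and \<open>\<mu>\<close> the point to divide out, the quotient is
  \<open>\<Sum>l. \<mu> ^ l * B ^ (l + 1) k\<close>, which converges absolutely as \<open>B\<close> is a contraction and
  \<open>norm \<mu> < 1\<close>.  Multiplied by \<open>z - \<mu>\<close> the series telescopes.
\<close>

lemma divide_out_root:
  assumes k: "k \<in> H"
  obtains q where "q \<in> H" "\<And>x. k x - k y = (Rep_disc x - Rep_disc y) * q x"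
proof -
  define \<mu> where "\<mu> = Rep_disc y"
  have \<mu>: "norm \<mu> < 1" unfolding \<mu>_def by (rule norm_Rep_disc)
  have "\<forall>f\<in>H. \<exists>g. g \<in> H \<and> nrm g \<le> nrm f \<and> (\<forall>x. f x = coef f 0 + Rep_disc x * g x)"
  proof
    fix f assume "f \<in> H"
    from backward_shift[OF this] obtain g
      where "g \<in> H" "nrm g \<le> nrm f" "\<And>x. f x = coef f 0 + Rep_disc x * g x" by blast
    then show "\<exists>g. g \<in> H \<and> nrm g \<le> nrm f \<and> (\<forall>x. f x = coef f 0 + Rep_disc x * g x)" by blast
  qed
  from bchoice[OF this] obtain B where B: "\<And>f. f \<in> H \<Longrightarrow> B f \<in> H" "\<And>f. f \<in> H \<Longrightarrow> nrm (B f) \<le> nrm f"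
      "\<And>f x. f \<in> H \<Longrightarrow> f x = coef f 0 + Rep_disc x * B f x"
    by blast
  define b where "b l = (B ^^ l) k" for l
  have b: "b l \<in> H \<and> nrm (b l) \<le> nrm k" for l
  proof (induction l)
    case 0
    then show ?case using k by (simp add: b_def)
  next
    case (Suc l)
    then have "B (b l) \<in> H" "nrm (B (b l)) \<le> nrm k" using B(1,2)[of "b l"] by auto
    then show ?case by (simp add: b_def)
  qed
  have bS: "b l x = coef (b l) 0 + Rep_disc x * b (Suc l) x" for l x
    using B(3)[of "b l" x] b[of l] by (simp add: b_def)
  define u where "u l = (\<lambda>x. \<mu> ^ l * b (Suc l) x)" for l
  have u: "u l \<in> H" for l unfolding u_def using b by (intro scale_mem) blast
  have Su: "summable (\<lambda>l. nrm (u l))"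
  proof (rule summable_comparison_test')
    show "summable (\<lambda>l. norm \<mu> ^ l * nrm k)"
      using \<mu> by (intro summable_mult2) (simp add: summable_geometric)
    show "norm (nrm (u l)) \<le> norm \<mu> ^ l * nrm k" for l
    proof -
      have bl: "b (Suc l) \<in> H" "nrm (b (Suc l)) \<le> nrm k" using b[of "Suc l"] by blast+
      have 1: "nrm (u l) = norm (\<mu> ^ l) * nrm (b (Suc l))"
        unfolding u_def by (rule nrm_scale[OF bl(1)])
      have 2: "norm \<mu> ^ l * nrm (b (Suc l)) \<le> norm \<mu> ^ l * nrm k"
        using bl(2) by (intro mult_left_mono) auto
      have 3: "0 \<le> nrm (u l)" by (rule nrm_nonneg[OF u])
      show ?thesis using 1 2 3 by (simp add: norm_power)
    qed
  qed
  obtain q where q: "q \<in> H" "\<And>x. (\<lambda>l. u l x) sums q x"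
      "\<And>h. h \<in> H \<Longrightarrow> (\<lambda>l. ip (u l) h) sums ip q h"
    by (rule norm_summable[of u, OF u Su], rule that)
  have "k x - k y = (Rep_disc x - Rep_disc y) * q x" for x
  proof (rule sums_unique2)
    define E where "E l = \<mu> ^ l * (b l x - b l y)" for l
    have E1: "E (Suc l) = \<mu> * (u l x - u l y)" for l by (simp add: E_def u_def algebra_simps)
    have "(\<lambda>l. \<mu> * (u l x - u l y)) \<longlonglongrightarrow> \<mu> * (0 - 0)"
      by (intro tendsto_intros summable_LIMSEQ_zero sums_summable[OF q(2)])
    then have "(\<lambda>l. E (Suc l)) \<longlonglongrightarrow> 0" by (simp add: E1)
    then have "E \<longlonglongrightarrow> 0" by (rule LIMSEQ_imp_Suc)
    then have "(\<lambda>l. E l - E (Suc l)) sums (E 0 - 0)" by (rule telescope_sums')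
    then show "(\<lambda>l. E l - E (Suc l)) sums (k x - k y)" by (simp add: E_def b_def)
    have "(Rep_disc x - Rep_disc y) * u l x = E l - E (Suc l)" for l
      unfolding E_def u_def bS[of l x] bS[of l y] by (simp add: \<mu>_def algebra_simps)
    then show "(\<lambda>l. E l - E (Suc l)) sums ((Rep_disc x - Rep_disc y) * q x)"
      using sums_mult[OF q(2), of "Rep_disc x - Rep_disc y" x] by simp
  qed
  then show ?thesis using that q(1) by blast
qed

lemma one_mem: "(\<lambda>x. 1) \<in> H"
  using zpow_mem[of 0] by (simp add: zpow_def[abs_def])

lemma Mult_imp_mem: "f \<in> Mult H \<Longrightarrow> f \<in> H"
proof -
  assume "f \<in> Mult H"
  then have "f * (\<lambda>x. 1) \<in> H" using one_mem by (simp add: Mult_def del: times_fun_apply)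
  moreover have "f * (\<lambda>x. 1) = f" by (simp add: fun_eq_iff)
  ultimately show ?thesis by simp
qed

lemma Mult_const: "(\<lambda>x. c) \<in> Mult H"
  unfolding Mult_def using scale_mem by (simp add: times_fun_def)

lemma Mult_times: "f \<in> Mult H \<Longrightarrow> g \<in> Mult H \<Longrightarrow> f * g \<in> Mult H"
  unfolding Mult_def by (simp add: mult.assoc)

lemma Mult_scale: "f \<in> Mult H \<Longrightarrow> (\<lambda>x. c * f x) \<in> Mult H"
  using Mult_times[OF Mult_const[of c], of f] by (simp add: times_fun_def)

lemma Mult_add: "f \<in> Mult H \<Longrightarrow> g \<in> Mult H \<Longrightarrow> f + g \<in> Mult H"
  unfolding Mult_def by (simp add: distrib_right add_mem)

lemma Mult_zpow: "zpow n \<in> Mult H"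
  unfolding Mult_def using shift by simp

text \<open>
  Multiplication by \<open>zpow n\<close> has norm at most \<open>sqrt (v n)\<close>, so the assumption is absolute
  convergence in the multiplier norm.  Several indices \<open>k\<close> may share the exponent \<open>N k\<close>.
\<close>

lemma Mult_series:
  assumes S: "summable (\<lambda>k. norm (c k) * sqrt (v (N k)))"
  obtains f where "f \<in> Mult H" "\<And>x. (\<lambda>k. c k * zpow (N k) x) sums f x"
    "\<And>n. (\<lambda>k. if N k = n then c k else 0) sums coef f n"
proof -
  have *: "\<exists>F\<in>H. (\<forall>x. (\<lambda>k. c k * zpow (N k) x * h x) sums F x) \<and>
     (\<forall>g\<in>H. (\<lambda>k. ip (\<lambda>x. c k * (zpow (N k) * h) x) g) sums ip F g)" if h: "h \<in> H" for h
  proof -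
    define u where "u k = (\<lambda>x. c k * (zpow (N k) * h) x)" for k
    have u: "u k \<in> H" for k unfolding u_def by (rule scale_mem[OF shift(1)[OF h]])
    have Su: "summable (\<lambda>k. nrm (u k))"
    proof (rule summable_comparison_test')
      show "summable (\<lambda>k. norm (c k) * sqrt (v (N k)) * nrm h)"
        by (rule summable_mult2[OF S])
      show "norm (nrm (u k)) \<le> norm (c k) * sqrt (v (N k)) * nrm h" for k
      proof -
        have "nrm (u k) = norm (c k) * nrm (zpow (N k) * h)"
          unfolding u_def by (rule nrm_scale[OF shift(1)[OF h]])
        also have "\<dots> \<le> norm (c k) * (sqrt (v (N k)) * nrm h)"
          by (rule mult_left_mono[OF shift(2)[OF h]]) simp
        finally show ?thesis using nrm_nonneg[OF u, of k] by (simp add: mult.assoc)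
      qed
    qed
    obtain F where "F \<in> H" "\<And>x. (\<lambda>k. u k x) sums F x" "\<And>g. g \<in> H \<Longrightarrow> (\<lambda>k. ip (u k) g) sums ip F g"
      by (rule norm_summable[of u, OF u Su], rule that)
    then show ?thesis unfolding u_def by (auto simp: mult.assoc)
  qed
  have one: "zpow n * (\<lambda>x. 1) = zpow n" for n by (simp add: fun_eq_iff)
  from *[OF one_mem] obtain f where f: "f \<in> H" "\<And>x. (\<lambda>k. c k * zpow (N k) x) sums f x"
    and fi: "\<And>g. g \<in> H \<Longrightarrow> (\<lambda>k. ip (\<lambda>x. c k * zpow (N k) x) g) sums ip f g"
    unfolding one by auto
  have "f * h \<in> H" if h: "h \<in> H" for h
  proof -
    obtain F where F: "F \<in> H" "\<And>x. (\<lambda>k. c k * zpow (N k) x * h x) sums F x"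
      using *[OF h] by blast
    have "F x = (f * h) x" for x
      using sums_unique2[OF F(2)[of x] sums_mult2[OF f(2)[of x], of "h x"]] by simp
    then have "F = f * h" by blast
    then show ?thesis using F(1) by simp
  qed
  then have M: "f \<in> Mult H" by (simp add: Mult_def)
  have "(\<lambda>k. if N k = n then c k else 0) sums coef f n" for n
  proof -
    have "(\<lambda>k. if N k = n then c k else 0) = (\<lambda>k. ip (\<lambda>x. c k * zpow (N k) x) (zpow n) / of_real (v n))"
      using v_pos[of n] by (auto simp: fun_eq_iff ip_scale_left zpow_mem zpow_orth)
    then show ?thesis unfolding coef_def using sums_divide[OF fi[OF zpow_mem]] by simp
  qed
  then show ?thesis using that M f(2) by blast
qed

lemma summable_poly_geometric:
  assumes "0 \<le> q" "q < 1"
  shows "summable (\<lambda>n. q ^ n * v n)"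
proof (cases "q = 0")
  case True
  then show ?thesis by (auto intro!: summable_finite[of "{0}"])
next
  case False
  then have q: "0 < q" "q < 1" using assms by auto
  define r where "r = sqrt q"
  have r: "0 < r" "r < 1" "q = r * r" using q by (auto simp: r_def)
  have "(\<lambda>n. r ^ n * v n) \<in> O(\<lambda>n. 1)"
    unfolding v_def using r(1,2) by real_asymp
  then have "(\<lambda>n. r ^ n * (r ^ n * v n)) \<in> O(\<lambda>n. r ^ n * 1)"
    by (rule landau_o.big.mult_left)
  then have "(\<lambda>n. q ^ n * v n) \<in> O(\<lambda>n. r ^ n)"
    by (simp add: r(3) power_mult_distrib mult.assoc)
  then show ?thesis
    by (rule summable_comparison_test_bigo[rotated]) (use r in \<open>simp add: summable_geometric\<close>)
qed

text \<open>
  The Neumann series of \<open>1 / (z - c)\<close> converges in the multiplier norm, since the norms of the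
  powers of \<open>z\<close> grow only polynomially.
\<close>

lemma Mult_resolvent:
  assumes c: "1 < norm c"
  obtains g where "g \<in> Mult H" "\<And>x. (Rep_disc x - c) * g x = 1"
proof -
  have "summable (\<lambda>k. norm (inverse c ^ Suc k) * sqrt (v k))"
  proof (rule summable_comparison_test')
    have "summable (\<lambda>k. norm (inverse c) ^ k * v k)"
      using c by (intro summable_poly_geometric) (auto simp: norm_inverse inverse_le_1_iff inverse_less_1_iff)
    then show "summable (\<lambda>k. norm (inverse c) * (norm (inverse c) ^ k * v k))" by (rule summable_mult)
    have "sqrt (v k) \<le> v k" for k
      using v_ge_1[of k] by (intro real_le_lsqrt) (auto simp: power2_eq_square)
    then show "norm (norm (inverse c ^ Suc k) * sqrt (v k)) \<le> norm (inverse c) * (norm (inverse c) ^ k * v k)" for k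
      using v_pos[of k] by (auto simp: norm_mult norm_power mult.assoc less_imp_le intro!: mult_left_mono)
  qed
  then obtain f where f: "f \<in> Mult H" "\<And>x. (\<lambda>k. inverse c ^ Suc k * zpow k x) sums f x"
    using Mult_series[of "\<lambda>k. inverse c ^ Suc k" "\<lambda>k. k"] by metis
  have "(Rep_disc x - c) * (-1 * f x) = 1" for x
  proof -
    have c0: "c \<noteq> 0" using c by auto
    have "norm (Rep_disc x / c) < 1"
      using norm_Rep_disc[of x] c by (simp add: norm_divide divide_less_eq)
    then have "(\<lambda>k. inverse c * (Rep_disc x / c) ^ k) sums (inverse c * (1 / (1 - Rep_disc x / c)))"
      by (intro sums_mult geometric_sums)
    moreover have "(\<lambda>k. inverse c * (Rep_disc x / c) ^ k) = (\<lambda>k. inverse c ^ Suc k * zpow k x)"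
      by (simp add: zpow_def divide_inverse power_mult_distrib mult_ac)
    ultimately have "f x = inverse c * (1 / (1 - Rep_disc x / c))"
      using sums_unique2[OF f(2)] by metis
    moreover have "Rep_disc x \<noteq> c" using norm_Rep_disc[of x] c by auto
    ultimately show ?thesis using c0 by (simp add: field_simps)
  qed
  then show ?thesis using that Mult_scale[OF f(1), of "-1"] by blast
qed

lemma continuous_at:
  assumes "f \<in> H"
  shows "isCont (\<lambda>z. f (Abs_disc z)) (Rep_disc y)"
  using holomorphic_on_imp_continuous_on[OF mem_holomorphic[OF assms]] norm_Rep_disc[of y]
  by (simp add: continuous_on_eq_continuous_at)

text \<open>
  Division by \<open>z - \<mu>\<close> determines a function only away from \<open>\<mu>\<close>; continuity supplies the missing
  point.
\<close>

lemma eq_at_removed_point: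
  assumes f: "f \<in> H" and g: "g \<in> H" "g' \<in> H" and eq: "\<And>x. x \<noteq> y \<Longrightarrow> f x = g x * g' x"
  shows "f = g * g'"
proof -
  define F where "F z = f (Abs_disc z) - g (Abs_disc z) * g' (Abs_disc z)" for z
  have "isCont F (Rep_disc y)"
    unfolding F_def
    by (rule continuous_diff[OF continuous_at[OF f] continuous_mult[OF continuous_at[OF g(1)] continuous_at[OF g(2)]]])
  then have lim: "(F \<longlongrightarrow> F (Rep_disc y)) (at (Rep_disc y))" by (simp add: isCont_def)
  have "\<forall>\<^sub>F z in at (Rep_disc y). z \<in> ball 0 1 - {Rep_disc y}"
    using norm_Rep_disc[of y] by (intro eventually_at_in_open) auto
  then have "\<forall>\<^sub>F z in at (Rep_disc y). F z = 0"
  proof (rule eventually_mono)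
    fix z assume z: "z \<in> ball 0 1 - {Rep_disc y}"
    then have "Abs_disc z \<noteq> y" by (auto simp: Rep_Abs_disc)
    then show "F z = 0" using eq[of "Abs_disc z"] by (simp add: F_def)
  qed
  then have "(F \<longlongrightarrow> 0) (at (Rep_disc y))" by (rule tendsto_eventually)
  then have "F (Rep_disc y) = 0" by (rule tendsto_unique[OF trivial_limit_at lim])
  then have "f y = g y * g' y" by (simp add: F_def Rep_disc_inverse)
  then have "f x = g x * g' x" for x using eq[of x] by (cases "x = y") auto
  then show ?thesis by (simp add: fun_eq_iff)
qed

text \<open>
  If \<open>f - f y = (z - y) q\<close> and \<open>h\<close> is in \<open>H\<close>, then \<open>(f - f y) h\<close> is in \<open>H\<close> and vanishes at \<open>y\<close>.
  Its quotient by \<open>z - y\<close> lies in \<open>H\<close> and is \<open>q h\<close>.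
\<close>

lemma Mult_divide_out_root:
  assumes f: "f \<in> Mult H"
  obtains g where "g \<in> Mult H" "\<And>x. f x - f y = (Rep_disc x - Rep_disc y) * g x"
proof -
  obtain q where q: "q \<in> H" "\<And>x. f x - f y = (Rep_disc x - Rep_disc y) * q x"
    using divide_out_root[OF Mult_imp_mem[OF f]] by metis
  have "q * h \<in> H" if h: "h \<in> H" for h
  proof -
    define k where "k = f * h - (\<lambda>x. f y * h x)"
    have k: "k \<in> H" using f h by (auto simp: k_def Mult_def intro!: diff_mem scale_mem)
    obtain p where p: "p \<in> H" "\<And>x. k x - k y = (Rep_disc x - Rep_disc y) * p x"
      using divide_out_root[OF k] by metis
    have "p = q * h"
    proof (rule eq_at_removed_point[OF p(1) q(1) h])
      fix x assume "x \<noteq> y"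
      then have "Rep_disc x - Rep_disc y \<noteq> 0" by (simp add: Rep_disc_inject)
      moreover have "(Rep_disc x - Rep_disc y) * p x = (f x - f y) * h x"
        using p(2)[of x] by (simp add: k_def algebra_simps)
      ultimately show "p x = q x * h x" unfolding q(2) by simp
    qed
    then show ?thesis using p(1) by simp
  qed
  then show ?thesis using that q(2) by (auto simp: Mult_def)
qed

end

section \<open>Rotation invariance\<close>

definition rot :: "complex \<Rightarrow> disc \<Rightarrow> disc" where
  "rot c x = Abs_disc (c * Rep_disc x)"

lemma Rep_rot: "norm c = 1 \<Longrightarrow> Rep_disc (rot c x) = c * Rep_disc x"
  unfolding rot_def using norm_Rep_disc[of x] by (intro Rep_Abs_disc) (simp add: norm_mult)

lemma rot_rot: "norm c = 1 \<Longrightarrow> norm d = 1 \<Longrightarrow> rot c (rot d x) = rot (c * d) x"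
  by (simp add: rot_def[of c] Rep_rot) (simp add: rot_def mult.assoc)

lemma rot_1: "rot 1 x = x" by (simp add: rot_def Rep_disc_inverse)

context disc_space
begin

lemma rot_mem:
  assumes c: "norm c = 1" and f: "f \<in> H"
  shows "f \<circ> rot c \<in> H"
proof (rule mem_of_coefficients)
  show "wl2 (\<lambda>n. coef f n * c ^ n)"
    using Bessel[OF f] c by (simp add: wl2_def norm_mult norm_power)
  show "(\<lambda>n. coef f n * c ^ n * Rep_disc x ^ n) sums (f \<circ> rot c) x" for x
    using coef_sums[OF f, of "rot c x"] by (simp add: Rep_rot c power_mult_distrib mult.assoc)
qed

lemma Mult_rot:
  assumes c: "norm c = 1" and f: "f \<in> Mult H"
  shows "f \<circ> rot c \<in> Mult H"
  unfolding Mult_def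
proof safe
  fix h assume h: "h \<in> H"
  have c': "norm (inverse c) = 1" "c \<noteq> 0" using c by (auto simp: norm_inverse)
  have "f * (h \<circ> rot (inverse c)) \<in> H" using f rot_mem[OF c'(1) h] by (simp add: Mult_def)
  from rot_mem[OF c this] have "(f * (h \<circ> rot (inverse c))) \<circ> rot c \<in> H" .
  also have "(f * (h \<circ> rot (inverse c))) \<circ> rot c = (f \<circ> rot c) * h"
    using c c' by (auto simp: fun_eq_iff rot_rot rot_1)
  finally show "(f \<circ> rot c) * h \<in> H" .
qed

end

section \<open>Distinct parameters give distinct sets of multipliers\<close>

text \<open>
  The coefficients \<open>c k = 2 ^ (-k) / sqrt (T.v (N k))\<close> make the series \<open>\<Sum>k. c k * z ^ N k\<close> converge
  absolutely in the multiplier norm of \<open>H'\<close>.  Its terms in \<open>H\<close> have squared norm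
  \<open>4 ^ (-k) * (N k + 1) powr (t - s)\<close>, which is at least \<open>1\<close> for \<open>N k = 2 ^ (j * k)\<close> with
  \<open>j * (t - s) \<ge> 2\<close>.
\<close>

lemma Mult_neq:
  assumes S: "disc_space H ip s" and T: "disc_space H' ip' t" and st: "s < t"
  shows "Mult H \<noteq> Mult H'"
proof
  assume eq: "Mult H = Mult H'"
  interpret S: disc_space H ip s by (rule S)
  interpret T: disc_space H' ip' t by (rule T)
  obtain j :: nat where j: "2 / (t - s) \<le> real j" using real_arch_simple by blast
  have "0 < 2 / (t - s)" using st by simp
  then have j0: "0 < j" using j by (cases j) auto
  have jt: "2 \<le> real j * (t - s)" using j st by (simp add: field_simps)
  define N :: "nat \<Rightarrow> nat" where "N k = 2 ^ (j * k)" for k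
  have injN: "N k = N l \<longleftrightarrow> k = l" for k l using j0 by (auto simp: N_def power_inject_exp)
  define c :: "nat \<Rightarrow> real" where "c k = (1/2) ^ k / sqrt (T.v (N k))" for k
  have "norm (complex_of_real (c k)) * sqrt (T.v (N k)) = (1/2) ^ k" for k
    using T.v_pos[of "N k"] by (simp add: c_def norm_divide norm_power)
  then have "summable (\<lambda>k. norm (complex_of_real (c k)) * sqrt (T.v (N k)))"
    by (simp add: summable_geometric)
  then obtain f where f: "f \<in> Mult H'"
      "\<And>n. (\<lambda>k. if N k = n then complex_of_real (c k) else 0) sums T.coef f n"
    using T.Mult_series[of "\<lambda>k. complex_of_real (c k)" N] by metis
  have cf: "T.coef f (N k) = c k" for k
    using sums_unique2[OF f(2)[of "N k", unfolded injN] sums_single[of k "\<lambda>k. complex_of_real (c k)"]] .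
  have "f \<in> H" using f(1) eq S.Mult_imp_mem by simp
  then have "S.coef f = T.coef f"
    using S.coef_eqI T.coef_sums[OF T.Mult_imp_mem[OF f(1)]] by blast
  then have "summable (\<lambda>n. S.v n * (norm (T.coef f n))\<^sup>2)"
    using S.Bessel[OF \<open>f \<in> H\<close>] by (simp add: S.wl2_def)
  then have "(\<lambda>n. S.v n * (norm (T.coef f n))\<^sup>2) \<longlonglongrightarrow> 0" by (rule summable_LIMSEQ_zero)
  then have ev: "\<forall>\<^sub>F n in sequentially. S.v n * (norm (T.coef f n))\<^sup>2 < 1"
    by (rule order_tendstoD) simp
  have mono: "strict_mono N" unfolding N_def strict_mono_def using j0 by (auto intro!: power_strict_increasing)
  have "\<forall>\<^sub>F k in sequentially. S.v (N k) * (norm (T.coef f (N k)))\<^sup>2 < 1"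
    by (rule eventually_compose_filterlim[OF ev filterlim_subseq[OF mono]])
  then obtain k where "S.v (N k) * (norm (T.coef f (N k)))\<^sup>2 < 1"
    by (auto simp: eventually_sequentially)
  moreover have "S.v (N k) * (norm (T.coef f (N k)))\<^sup>2 = (1/4) ^ k * (real (N k + 1) powr (t - s))"
  proof -
    have "(norm (T.coef f (N k)))\<^sup>2 = (1/4) ^ k / T.v (N k)"
    proof -
      have "(norm (T.coef f (N k)))\<^sup>2 = (c k)\<^sup>2" unfolding cf by simp
      also have "\<dots> = ((1/2) ^ k)\<^sup>2 / T.v (N k)"
        using T.v_pos[of "N k"] by (simp add: c_def power_divide power_mult_distrib)
      also have "((1/2) ^ k)\<^sup>2 = ((1/4::real)) ^ k"
        by (simp add: power2_eq_square power_mult_distrib[symmetric])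
      finally show ?thesis .
    qed
    then show ?thesis
      by (simp add: S.v_def T.v_def powr_diff powr_minus divide_simps)
  qed
  moreover have "4 ^ k \<le> real (N k + 1) powr (t - s)"
  proof -
    have "4 ^ k = (2::real) powr (2 * real k)"
      by (simp add: powr_powr[symmetric] powr_realpow)
    also have "\<dots> \<le> 2 powr (real j * (t - s) * real k)"
      using jt by (intro powr_mono mult_right_mono) auto
    also have "\<dots> = real (N k) powr (t - s)"
      by (simp add: N_def powr_realpow[symmetric] powr_powr mult_ac)
    also have "\<dots> \<le> real (N k + 1) powr (t - s)"
      using st by (intro powr_mono2) auto
    finally show ?thesis .
  qed
  then have "(1/4) ^ k * 4 ^ k \<le> (1/4::real) ^ k * real (N k + 1) powr (t - s)"
    by (rule mult_left_mono) simp
  moreover have "(1/4) ^ k * 4 ^ k = (1::real)" by (simp add: power_mult_distrib[symmetric])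
  ultimately show False by linarith
qed

section \<open>Automorphisms of the disc\<close>

definition hol_disc :: "(disc \<Rightarrow> disc) \<Rightarrow> bool" where
  "hol_disc \<theta> \<longleftrightarrow> (\<lambda>z. Rep_disc (\<theta> (Abs_disc z))) holomorphic_on ball 0 1"

lemma hol_disc_comp:
  assumes "hol_disc \<theta>" "hol_disc \<psi>"
  shows "hol_disc (\<theta> \<circ> \<psi>)"
proof -
  have "((\<lambda>z. Rep_disc (\<theta> (Abs_disc z))) \<circ> (\<lambda>z. Rep_disc (\<psi> (Abs_disc z)))) holomorphic_on ball 0 1"
    using assms norm_Rep_disc unfolding hol_disc_def
    by (intro holomorphic_on_compose_gen[where t = "ball 0 1"]) auto
  then show ?thesis by (simp add: hol_disc_def o_def Rep_disc_inverse)
qed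

lemma hol_disc_rot: "norm c = 1 \<Longrightarrow> hol_disc (rot c)"
proof -
  assume c: "norm c = 1"
  have "(\<lambda>z. c * z) holomorphic_on ball 0 1" by (intro holomorphic_intros)
  then show ?thesis unfolding hol_disc_def
    by (rule holomorphic_transform) (simp add: Rep_rot c Rep_Abs_disc)
qed

lemma Schwarz_disc:
  assumes "hol_disc \<theta>" "Rep_disc (\<theta> (Abs_disc 0)) = 0"
  shows "norm (Rep_disc (\<theta> x)) \<le> norm (Rep_disc x)"
    and "Rep_disc x \<noteq> 0 \<Longrightarrow> norm (Rep_disc (\<theta> x)) = norm (Rep_disc x) \<Longrightarrow> \<exists>c. norm c = 1 \<and> \<theta> = rot c"
proof -
  note S = Schwarz_Lemma[OF assms(1)[unfolded hol_disc_def] assms(2) norm_Rep_disc]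
  show "norm (Rep_disc (\<theta> x)) \<le> norm (Rep_disc x)"
    using S(1)[OF norm_Rep_disc, of x] by (simp add: Rep_disc_inverse)
  assume x: "Rep_disc x \<noteq> 0" "norm (Rep_disc (\<theta> x)) = norm (Rep_disc x)"
  then have "\<exists>z. norm z < 1 \<and> z \<noteq> 0 \<and> norm (Rep_disc (\<theta> (Abs_disc z))) = norm z"
    by (intro exI[of _ "Rep_disc x"]) (simp add: Rep_disc_inverse norm_Rep_disc)
  then obtain c where c: "\<And>z. norm z < 1 \<Longrightarrow> Rep_disc (\<theta> (Abs_disc z)) = c * z" "norm c = 1"
    using S(3)[of 0] by auto
  have "\<theta> y = rot c y" for y
    using c(1)[OF norm_Rep_disc, of y] Rep_rot[OF c(2), of y] by (simp add: Rep_disc_inverse Rep_disc_inject[symmetric])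
  then show "\<exists>c. norm c = 1 \<and> \<theta> = rot c" using c(2) by blast
qed

text \<open>
  The Schwarz lemma for the map and for its inverse gives equality of moduli.
\<close>

lemma biholomorphic_fix_0_rot:
  assumes h: "hol_disc \<theta>" "hol_disc \<theta>'" and inv: "\<And>x. \<theta>' (\<theta> x) = x"
    and z0: "\<theta> (Abs_disc 0) = Abs_disc 0"
  obtains c where "norm c = 1" "\<theta> = rot c"
proof -
  have z0': "\<theta>' (Abs_disc 0) = Abs_disc 0" using inv[of "Abs_disc 0"] z0 by simp
  have R0: "Rep_disc (Abs_disc 0) = 0" by (simp add: Rep_Abs_disc)
  define x where "x = Abs_disc (1/2)"
  have x: "Rep_disc x \<noteq> 0" unfolding x_def by (subst Rep_Abs_disc) auto
  have "norm (Rep_disc (\<theta> x)) \<le> norm (Rep_disc x)"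
    by (rule Schwarz_disc(1)[OF h(1)]) (simp add: z0 R0)
  moreover have "norm (Rep_disc (\<theta>' (\<theta> x))) \<le> norm (Rep_disc (\<theta> x))"
    by (rule Schwarz_disc(1)[OF h(2)]) (simp add: z0' R0)
  ultimately have "norm (Rep_disc (\<theta> x)) = norm (Rep_disc x)" by (simp add: inv)
  then show ?thesis using Schwarz_disc(2)[OF h(1) _ x] that by (auto simp: z0 R0)
qed

text \<open>
  Let \<open>a = \<theta>' 0\<close>, a zero of \<open>\<theta>\<close>.  On the circle through \<open>a\<close> around the origin the modulus of \<open>\<theta>\<close>
  takes the value \<open>0\<close>, and by the maximum modulus principle some value at least as large as the
  modulus at the centre.  The circle is connected, so the modulus at the centre is attained on it.
\<close>

lemma exists_equimodular_point:
  assumes h: "hol_disc \<theta>"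
    and inv: "\<And>x. \<theta> (\<theta>' x) = x"
  obtains c where "norm c = 1"
    "norm (Rep_disc (\<theta> (rot c (\<theta>' (Abs_disc 0))))) = norm (Rep_disc (\<theta> (Abs_disc 0)))"
proof -
  define a where "a = Rep_disc (\<theta>' (Abs_disc 0))"
  define f where "f z = Rep_disc (\<theta> (Abs_disc z))" for z
  have a: "norm a < 1" unfolding a_def by (rule norm_Rep_disc)
  have hol: "f holomorphic_on ball 0 1" using h unfolding hol_disc_def f_def .
  have cb: "cball 0 (norm a) \<subseteq> ball (0::complex) 1" using a by auto
  have fa: "f a = 0" by (simp add: f_def a_def Rep_disc_inverse inv Rep_Abs_disc)
  have cont: "continuous_on (sphere 0 (norm a)) (\<lambda>z. norm (f z))"
    using cb by (intro continuous_intros holomorphic_on_imp_continuous_on[OF holomorphic_on_subset[OF hol]]) auto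
  have "\<exists>z\<in>sphere 0 (norm a). norm (f z) = norm (f 0)"
  proof (cases "a = 0")
    case True
    then show ?thesis by simp
  next
    case False
    have "\<exists>w\<in>sphere 0 (norm a). norm (f 0) \<le> norm (f w)"
    proof (rule ccontr)
      assume "\<not> ?thesis"
      then have less: "\<And>w. w \<in> sphere 0 (norm a) \<Longrightarrow> norm (f w) < norm (f 0)"
        by (meson not_le)
      obtain w where w: "w \<in> sphere 0 (norm a)" "\<And>z. z \<in> sphere 0 (norm a) \<Longrightarrow> norm (f z) \<le> norm (f w)"
        using continuous_attains_sup[OF compact_sphere _ cont] by auto
      have "norm (f 0) \<le> norm (f w)"
      proof (rule maximum_modulus_frontier[of f "cball 0 (norm a)"])
        show "f holomorphic_on interior (cball 0 (norm a))"
          using cb by (intro holomorphic_on_subset[OF hol]) (auto simp: interior_cball)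
        show "continuous_on (closure (cball 0 (norm a))) f"
          using cb by (intro holomorphic_on_imp_continuous_on holomorphic_on_subset[OF hol]) auto
        show "norm (f z) \<le> norm (f w)" if "z \<in> frontier (cball 0 (norm a))" for z
          using that w(2) by (simp add: frontier_cball)
      qed auto
      then show False using less[OF w(1)] by simp
    qed
    then obtain w where w: "w \<in> sphere 0 (norm a)" "norm (f 0) \<le> norm (f w)" by blast
    have "connected ((\<lambda>z. norm (f z)) ` sphere 0 (norm a))"
      by (intro connected_continuous_image cont connected_sphere) simp
    moreover have "norm (f a) \<in> (\<lambda>z. norm (f z)) ` sphere 0 (norm a)"
      "norm (f w) \<in> (\<lambda>z. norm (f z)) ` sphere 0 (norm a)" using w by auto
    ultimately have "norm (f 0) \<in> (\<lambda>z. norm (f z)) ` sphere 0 (norm a)"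
      using w(2) fa unfolding connected_iff_interval by (metis norm_ge_zero norm_zero)
    then show ?thesis by force
  qed
  then obtain p where p: "norm p = norm a" "norm (f p) = norm (f 0)" by auto
  define c where "c = (if a = 0 then 1 else p / a)"
  have c: "norm c = 1" "c * a = p" using p(1) by (auto simp: c_def norm_divide)
  have "rot c (\<theta>' (Abs_disc 0)) = Abs_disc p" unfolding rot_def a_def[symmetric] c(2) ..
  then show ?thesis using that[OF c(1)] p(2) by (simp add: f_def)
qed

section \<open>Isomorphisms of multiplier algebras\<close>

lemma algebra_iso_inverse:
  assumes "algebra_iso A B \<phi>"
    and closed: "\<And>f g. f \<in> A \<Longrightarrow> g \<in> A \<Longrightarrow> f + g \<in> A" "\<And>c f. f \<in> A \<Longrightarrow> (\<lambda>x. c * f x) \<in> A"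
      "\<And>f g. f \<in> A \<Longrightarrow> g \<in> A \<Longrightarrow> f * g \<in> A"
  shows "algebra_iso B A (inv_into A \<phi>)"
proof -
  note a = assms(1)[unfolded algebra_iso_def]
  have b: "bij_betw \<phi> A B" using a by blast
  let ?\<psi> = "inv_into A \<phi>"
  have m: "?\<psi> g \<in> A" "\<phi> (?\<psi> g) = g" if "g \<in> B" for g
    using b that by (auto simp: bij_betw_def inv_into_into f_inv_into_f)
  have l: "?\<psi> g = f" if "f \<in> A" "\<phi> f = g" for f g
    using b that by (auto simp: bij_betw_def inv_into_f_f)
  have "?\<psi> (f + g) = ?\<psi> f + ?\<psi> g" if "f \<in> B" "g \<in> B" for f g
    using a m[OF that(1)] m[OF that(2)] by (intro l closed) auto
  moreover have "?\<psi> (f * g) = ?\<psi> f * ?\<psi> g" if "f \<in> B" "g \<in> B" for f g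
    using a m[OF that(1)] m[OF that(2)] by (intro l closed) auto
  moreover have "?\<psi> (\<lambda>x. c * f x) = (\<lambda>x. c * ?\<psi> f x)" if "f \<in> B" for f c
    using a m[OF that] by (intro l closed) auto
  ultimately show ?thesis
    unfolding algebra_iso_def using bij_betw_inv_into[OF b] by blast
qed

text \<open>
  The image \<open>\<theta>0\<close> of the coordinate function is a holomorphic function.  It omits every \<open>c\<close> outside
  the closed disc because \<open>z - c\<close> is invertible, and it is not constant because \<open>\<phi>\<close> is injective
  and fixes constants.  Divisibility of \<open>f - f (\<theta> y)\<close> by \<open>z - \<theta> y\<close> identifies \<open>\<phi>\<close>.
\<close>

lemma iso_is_composition:
  assumes S: "disc_space H ip s" and T: "disc_space H' ip' t"
    and iso: "algebra_iso (Mult H) (Mult H') \<phi>"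
  obtains \<theta> where "hol_disc \<theta>" "\<And>f. f \<in> Mult H \<Longrightarrow> \<phi> f = f \<circ> \<theta>"
proof -
  interpret S: disc_space H ip s by (rule S)
  interpret T: disc_space H' ip' t by (rule T)
  note a = iso[unfolded algebra_iso_def]
  have bij: "bij_betw \<phi> (Mult H) (Mult H')" using a by blast
  have add: "\<phi> (f + g) = \<phi> f + \<phi> g" and mult: "\<phi> (f * g) = \<phi> f * \<phi> g"
    if "f \<in> Mult H" "g \<in> Mult H" for f g using a that by auto
  have scale: "\<phi> (\<lambda>x. c * f x) = (\<lambda>y. c * \<phi> f y)" if "f \<in> Mult H" for f c using a that by blast
  have mem: "\<phi> f \<in> Mult H'" if "f \<in> Mult H" for f using bij that by (auto simp: bij_betw_def)
  have inj: "f = g" if "f \<in> Mult H" "g \<in> Mult H" "\<phi> f = \<phi> g" for f g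
    using bij that by (auto simp: bij_betw_def inj_on_def)
  have one: "\<phi> (\<lambda>x. 1) = (\<lambda>x. 1)"
  proof -
    obtain e where e: "e \<in> Mult H" "\<phi> e = (\<lambda>x. 1)"
      using bij T.Mult_const[of 1] unfolding bij_betw_def by (metis imageE)
    have "(\<lambda>x. 1) * e = e" by (simp add: fun_eq_iff)
    then have "\<phi> (\<lambda>x. 1) * (\<lambda>x. 1) = (\<lambda>x. 1)" using mult[OF S.Mult_const e(1), of 1] e(2) by simp
    then show ?thesis by (simp add: fun_eq_iff)
  qed
  have const: "\<phi> (\<lambda>x. c) = (\<lambda>x. c)" for c
    using scale[OF S.Mult_const[of 1], of c] one by simp
  define \<theta>0 where "\<theta>0 = \<phi> (zpow 1)"
  have lin: "\<phi> (\<lambda>x. Rep_disc x - c) = (\<lambda>x. \<theta>0 x - c)" for c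
  proof -
    have eq: "(\<lambda>x. Rep_disc x - c) = zpow 1 + (\<lambda>x. - c)" by (simp add: fun_eq_iff zpow_def)
    show ?thesis unfolding eq add[OF S.Mult_zpow S.Mult_const] const \<theta>0_def
      by (simp add: fun_eq_iff)
  qed
  have linM: "(\<lambda>x. Rep_disc x - c) \<in> Mult H" for c
  proof -
    have eq: "(\<lambda>x. Rep_disc x - c) = zpow 1 + (\<lambda>x. - c)" by (simp add: fun_eq_iff zpow_def)
    show ?thesis unfolding eq by (rule S.Mult_add[OF S.Mult_zpow S.Mult_const])
  qed
  have le1: "norm (\<theta>0 y) \<le> 1" for y
  proof (rule ccontr)
    assume "\<not> ?thesis"
    then have big: "1 < norm (\<theta>0 y)" by simp
    obtain g where g: "g \<in> Mult H" "\<And>x. (Rep_disc x - \<theta>0 y) * g x = 1"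
      by (rule S.Mult_resolvent[OF big], rule that)
    have "(\<lambda>x. Rep_disc x - \<theta>0 y) * g = (\<lambda>x. 1)" using g(2) by (simp add: fun_eq_iff)
    then have "(\<lambda>x. \<theta>0 x - \<theta>0 y) * \<phi> g = (\<lambda>x. 1)"
      using mult[OF linM g(1), of "\<theta>0 y"] by (simp add: lin one)
    then have "(\<theta>0 y - \<theta>0 y) * \<phi> g y = 1" by (metis times_fun_apply)
    then show False by simp
  qed
  define F where "F z = \<theta>0 (Abs_disc z)" for z
  have hol: "F holomorphic_on ball 0 1"
    unfolding F_def \<theta>0_def by (rule T.mem_holomorphic[OF T.Mult_imp_mem[OF mem[OF S.Mult_zpow]]])
  have nc: "\<not> F constant_on ball 0 1"
  proof
    assume "F constant_on ball 0 1"
    then obtain c where c: "\<And>z. z \<in> ball 0 1 \<Longrightarrow> F z = c" by (auto simp: constant_on_def)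
    have "\<theta>0 x = c" for x using c[of "Rep_disc x"] norm_Rep_disc[of x] by (simp add: F_def Rep_disc_inverse)
    then have "\<phi> (zpow 1) = \<phi> (\<lambda>x. c)" unfolding const \<theta>0_def[symmetric] by blast
    then have "zpow 1 = (\<lambda>x. c)" by (rule inj[OF S.Mult_zpow S.Mult_const])
    then have "zpow 1 (Abs_disc 0) = zpow 1 (Abs_disc (1/2))" by simp
    then show False by (simp add: zpow_def Rep_Abs_disc)
  qed
  have "open (F ` ball 0 1)"
    by (rule open_mapping_thm[OF hol _ _ _ _ nc]) auto
  moreover have "F ` ball 0 1 \<subseteq> cball 0 1" using le1 by (auto simp: F_def)
  ultimately have "F ` ball 0 1 \<subseteq> ball 0 1"
    using interior_maximal interior_cball by (metis)
  then have lt1: "norm (\<theta>0 x) < 1" for x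
    using norm_Rep_disc[of x] by (force simp: F_def Rep_disc_inverse image_subset_iff dest: bspec[of _ _ "Rep_disc x"])
  define \<theta> where "\<theta> x = Abs_disc (\<theta>0 x)" for x
  have R: "Rep_disc (\<theta> x) = \<theta>0 x" for x unfolding \<theta>_def by (rule Rep_Abs_disc[OF lt1])
  have "hol_disc \<theta>" using hol by (simp add: hol_disc_def R F_def[abs_def])
  moreover have "\<phi> f = f \<circ> \<theta>" if f: "f \<in> Mult H" for f
  proof
    fix y
    obtain g where g: "g \<in> Mult H" "\<And>x. f x - f (\<theta> y) = (Rep_disc x - Rep_disc (\<theta> y)) * g x"
      by (rule S.Mult_divide_out_root[OF f], rule that)
    have "f = (\<lambda>x. f (\<theta> y)) + (\<lambda>x. Rep_disc x - Rep_disc (\<theta> y)) * g"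
      using g(2) by (auto simp: fun_eq_iff algebra_simps)
    then have "\<phi> f = \<phi> (\<lambda>x. f (\<theta> y)) + \<phi> ((\<lambda>x. Rep_disc x - Rep_disc (\<theta> y)) * g)"
      using add[OF S.Mult_const S.Mult_times[OF linM g(1)]] by metis
    also have "\<dots> = (\<lambda>x. f (\<theta> y)) + (\<lambda>x. \<theta>0 x - Rep_disc (\<theta> y)) * \<phi> g"
      by (simp only: const mult[OF linM g(1)] lin)
    finally show "\<phi> f y = (f \<circ> \<theta>) y" by (simp add: R)
  qed
  ultimately show ?thesis using that by blast
qed

text \<open>
  Conjugating rotations by \<open>\<theta>\<close> yields further automorphisms that preserve \<open>Mult H\<close>.  With
  them \<open>\<theta>\<close> is corrected to a map that fixes the origin and still carries one algebra onto
  the other.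
\<close>

lemma Mult_eq_of_algebra_iso:
  assumes S: "disc_space H ip s" and T: "disc_space H' ip' t"
    and iso: "algebra_iso (Mult H) (Mult H') \<phi>"
  shows "Mult H = Mult H'"
proof -
  interpret S: disc_space H ip s by (rule S)
  interpret T: disc_space H' ip' t by (rule T)
  define \<psi> where "\<psi> = inv_into (Mult H) \<phi>"
  have iso': "algebra_iso (Mult H') (Mult H) \<psi>"
    unfolding \<psi>_def by (rule algebra_iso_inverse[OF iso S.Mult_add S.Mult_scale S.Mult_times])
  have bij: "bij_betw \<phi> (Mult H) (Mult H')" using iso by (simp add: algebra_iso_def)
  have \<psi>\<phi>: "\<psi> (\<phi> f) = f" if "f \<in> Mult H" for f
    using bij that by (simp add: \<psi>_def bij_betw_def inv_into_f_f)
  have \<phi>\<psi>: "\<phi> (\<psi> f) = f" if "f \<in> Mult H'" for f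
    using bij that by (simp add: \<psi>_def bij_betw_def f_inv_into_f)
  have \<phi>m: "\<phi> f \<in> Mult H'" if "f \<in> Mult H" for f using bij that by (auto simp: bij_betw_def)
  have \<psi>m: "\<psi> f \<in> Mult H" if "f \<in> Mult H'" for f
    using iso' that by (auto simp: algebra_iso_def bij_betw_def)
  obtain \<theta> where \<theta>: "hol_disc \<theta>" "\<And>f. f \<in> Mult H \<Longrightarrow> \<phi> f = f \<circ> \<theta>"
    by (rule iso_is_composition[OF S T iso], rule that)
  obtain \<theta>' where \<theta>': "hol_disc \<theta>'" "\<And>f. f \<in> Mult H' \<Longrightarrow> \<psi> f = f \<circ> \<theta>'"
    by (rule iso_is_composition[OF T S iso'], rule that)
  have 1: "\<theta> (\<theta>' x) = x" for x
  proof -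
    have "zpow 1 = zpow 1 \<circ> \<theta> \<circ> \<theta>'"
      using \<psi>\<phi>[OF S.Mult_zpow, of 1] \<theta>(2)[OF S.Mult_zpow, of 1] \<theta>'(2)[OF \<phi>m[OF S.Mult_zpow], of 1] by simp
    then have "zpow 1 x = zpow 1 (\<theta> (\<theta>' x))" by (metis comp_apply)
    then show ?thesis by (simp add: zpow_def Rep_disc_inject)
  qed
  have 2: "\<theta>' (\<theta> x) = x" for x
  proof -
    have "zpow 1 = zpow 1 \<circ> \<theta>' \<circ> \<theta>"
      using \<phi>\<psi>[OF T.Mult_zpow, of 1] \<theta>'(2)[OF T.Mult_zpow, of 1] \<theta>(2)[OF \<psi>m[OF T.Mult_zpow], of 1] by simp
    then have "zpow 1 x = zpow 1 (\<theta>' (\<theta> x))" by (metis comp_apply)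
    then show ?thesis by (simp add: zpow_def Rep_disc_inject)
  qed
  define z0 where "z0 = Abs_disc 0"
  obtain c where c: "norm c = 1" "norm (Rep_disc (\<theta> (rot c (\<theta>' z0)))) = norm (Rep_disc (\<theta> z0))"
    by (rule exists_equimodular_point[OF \<theta>(1) 1, folded z0_def], rule that)
  \<comment> \<open>The rotation that carries \<open>\<theta> z0\<close> to the point of equal modulus.\<close>
  define d where "d = (if Rep_disc (\<theta> z0) = 0 then 1 else Rep_disc (\<theta> (rot c (\<theta>' z0))) / Rep_disc (\<theta> z0))"
  have d: "norm d = 1" using c(2) by (auto simp: d_def norm_divide)
  have "Rep_disc (rot d (\<theta> z0)) = Rep_disc (\<theta> (rot c (\<theta>' z0)))"
    using c(2) by (simp add: Rep_rot[OF d]) (auto simp: d_def)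
  then have rd: "rot d (\<theta> z0) = \<theta> (rot c (\<theta>' z0))" by (simp add: Rep_disc_inject)
  have inv1: "norm (inverse e) = 1" "rot (inverse e) (rot e x) = x" "rot e (rot (inverse e) x) = x"
    if "norm e = 1" for e x
  proof -
    have "e \<noteq> 0" "norm (inverse e) = 1" using that by (auto simp: norm_inverse)
    then show "norm (inverse e) = 1" "rot (inverse e) (rot e x) = x" "rot e (rot (inverse e) x) = x"
      using that by (auto simp: rot_rot rot_1)
  qed
  \<comment> \<open>The origin travels to \<open>\<theta> z0\<close>, by \<open>rot d\<close> to \<open>\<theta> (rot c (\<theta>' z0))\<close>, on to \<open>rot c (\<theta>' z0)\<close>, back to \<open>\<theta>' z0\<close>, and to the origin.\<close>
  define \<omega> where "\<omega> = \<theta> \<circ> rot (inverse c) \<circ> \<theta>' \<circ> rot d \<circ> \<theta>"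
  define \<omega>' where "\<omega>' = \<theta>' \<circ> rot (inverse d) \<circ> \<theta> \<circ> rot c \<circ> \<theta>'"
  have "\<omega> z0 = z0" by (simp add: \<omega>_def rd 1 2 inv1[OF c(1)])
  moreover have "hol_disc \<omega>" "hol_disc \<omega>'"
    unfolding \<omega>_def \<omega>'_def by (intro hol_disc_comp hol_disc_rot \<theta>(1) \<theta>'(1) inv1 c(1) d)+
  moreover have "\<omega>' (\<omega> x) = x" for x
    by (simp add: \<omega>_def \<omega>'_def 1 2 inv1[OF c(1)] inv1[OF d])
  ultimately obtain e where e: "norm e = 1" "\<omega> = rot e"
    unfolding z0_def using biholomorphic_fix_0_rot[of \<omega> \<omega>'] by metis
  have A: "f \<circ> \<theta> \<in> Mult H'" if "f \<in> Mult H" for f using \<phi>m[OF that] \<theta>(2)[OF that] by simp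
  have B: "f \<circ> \<theta>' \<in> Mult H" if "f \<in> Mult H'" for f using \<psi>m[OF that] \<theta>'(2)[OF that] by simp
  show ?thesis
  proof
    show "Mult H \<subseteq> Mult H'"
    proof
      fix f assume f: "f \<in> Mult H"
      have "f \<circ> \<omega> \<in> Mult H'"
        unfolding \<omega>_def comp_assoc[symmetric]
        by (intro A B S.Mult_rot T.Mult_rot inv1 c(1) d f)
      then have "f \<circ> \<omega> \<circ> rot (inverse e) \<in> Mult H'" by (rule T.Mult_rot[OF inv1(1)[OF e(1)]])
      also have "f \<circ> \<omega> \<circ> rot (inverse e) = f" by (simp add: fun_eq_iff e(2) inv1[OF e(1)])
      finally show "f \<in> Mult H'" .
    qed
    show "Mult H' \<subseteq> Mult H"
    proof
      fix f assume f: "f \<in> Mult H'"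
      have "f \<circ> \<omega>' \<in> Mult H"
        unfolding \<omega>'_def comp_assoc[symmetric]
        by (intro A B S.Mult_rot T.Mult_rot inv1 c(1) d f)
      then have "f \<circ> \<omega>' \<circ> rot e \<in> Mult H" by (rule S.Mult_rot[OF e(1)])
      also have "f \<circ> \<omega>' \<circ> rot e = f"
        by (simp add: fun_eq_iff e(2)[symmetric] \<open>\<And>x. \<omega>' (\<omega> x) = x\<close>)
      finally show "f \<in> Mult H" .
    qed
  qed
qed

theorem corollary9p4:
  fixes s t :: real
    and H\<^sub>s H\<^sub>t :: "(disc \<Rightarrow> complex) set"
    and ip\<^sub>s ip\<^sub>t :: "(disc \<Rightarrow> complex) \<Rightarrow> (disc \<Rightarrow> complex) \<Rightarrow> complex"
  assumes "s \<le> 0" and "t \<le> 0" and "s \<noteq> t"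
    and "rkhs H\<^sub>s ip\<^sub>s (K_disc s)" and "rkhs H\<^sub>t ip\<^sub>t (K_disc t)"
  shows "\<not> algebras_isomorphic (Mult H\<^sub>s) (Mult H\<^sub>t)"
proof
  have S: "disc_space H\<^sub>s ip\<^sub>s s" and T: "disc_space H\<^sub>t ip\<^sub>t t"
    using assms by (auto simp: disc_space_def disc_space_axioms_def)
  assume "algebras_isomorphic (Mult H\<^sub>s) (Mult H\<^sub>t)"
  then have eq: "Mult H\<^sub>s = Mult H\<^sub>t"
    unfolding algebras_isomorphic_def using Mult_eq_of_algebra_iso[OF S T] by blast
  show False
    using Mult_neq[OF S T] Mult_neq[OF T S] eq assms(3) by (cases "s < t") auto
qed

end
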